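(* Let $M$ be a $(2n+1)$-dimensional smooth manifold with a contact structure $\xi$. The Lie bracket of two tangent vector fields $X,Y\in\mathrm{TVect}(M)$ is of the form $$[X,Y]=\mathcal{B}(X,Y)+(\text{tangent vector field}),$$ that is, $[X,Y]-\mathcal{B}(X,Y)\in\mathrm{TVect}(M)$.
   Context: A contact structure $\xi$ on a $(2n+1)$-dimensional smooth manifold $M$ ($n\ge 1$) is a codimension 1 distribution which is completely non-integrable: locally $\xi=\ker\alpha$ for a real 1-form $\alpha$ (a contact form, defined up to multiplication by a nonvanishing function) with $\alpha\wedge(d\alpha)^n\neq 0$ everywhere. All vector fields and functions are smooth with complex coefficients. $\mathrm{CVect}(M)$ is the Lie algebra of contact vector fields, i.e. of vector fields $X$ with $L_X\alpha=f_X\alpha$ for some function $f_X$, for every (local) contact form $\alpha$. $\mathrm{TVect}(M)$ is the space of vector fields tangent to $\xi$ (i.e. $\alpha(X)=0$ for every local contact form). Once a contact form $\alpha$ is fixed, a contact vector field $X$ is uniquely determined by its contact Hamiltonian, the function $H=\alpha(X)$, and every smooth function is the contact Hamiltonian of a unique contact vector field $X_H$. Replacing $\alpha$ by $f\alpha$ (with $f$ nonvanishing) replaces the contact Hamiltonian $H$ of a given contact vector field by $fH$. For $X,Y\in\mathrm{TVect}(M)$, and a (local) contact form $\alpha$, put $H_{X,Y}=\langle X\wedge Y, d\alpha\rangle$, with the convention $\langle X\wedge Y,d\alpha\rangle=i_Xi_Y\,d\alpha=d\alpha(Y,X)$. When $\alpha$ is replaced by $f\alpha$, $H_{X,Y}$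 is replaced by $fH_{X,Y}$. $\mathcal{B}(X,Y)\in\mathrm{CVect}(M)$ denotes the contact vector field whose contact Hamiltonian with respect to $\alpha$ is $H_{X,Y}$; it does not depend on the choice of $\alpha$. *)

theory Defs
  imports "HOL-Analysis.Analysis"
begin

section \<open>Smooth functions and smooth manifolds\<close>

text \<open>Only used for open sets \<open>S\<close>.\<close>

primrec Ck_on :: "nat \<Rightarrow> 'e::real_normed_vector set \<Rightarrow> ('e \<Rightarrow> 'b::real_normed_vector) \<Rightarrow> bool" where
  "Ck_on 0 S f \<longleftrightarrow> continuous_on S f"
| "Ck_on (Suc k) S f \<longleftrightarrow>
     (\<forall>x\<in>S. f differentiable (at x)) \<and> (\<forall>v. Ck_on k S (\<lambda>x. frechet_derivative f (at x) v))"

definition smooth_on :: "'e::real_normed_vector set \<Rightarrow> ('e \<Rightarrow> 'b::real_normed_vector) \<Rightarrow> bool" where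
  "smooth_on S f \<longleftrightarrow> (\<forall>k. Ck_on k S f)"

text \<open>
  The manifold is the whole type \<open>'a\<close>. A chart is a pair of its domain and its coordinate map;
  the values of the coordinate map outside the domain are irrelevant.
\<close>

type_synonym ('a, 'm) chart = "'a set \<times> ('a \<Rightarrow> real^'m)"

definition chart_inv :: "('a, 'm::finite) chart \<Rightarrow> real^'m \<Rightarrow> 'a" where
  "chart_inv c = inv_into (fst c) (snd c)"

definition smooth_atlas ::
    "('a::{t2_space, second_countable_topology}, 'm::finite) chart set \<Rightarrow> bool" where
  "smooth_atlas A \<longleftrightarrow>
     (\<forall>c\<in>A. open (fst c) \<and> open (snd c ` fst c) \<and>
        homeomorphism (fst c) (snd c ` fst c) (snd c) (chart_inv c)) \<and>
     (\<Union>c\<in>A. fst c) = UNIV \<and>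
     (\<forall>c\<in>A. \<forall>d\<in>A. smooth_on (snd c ` (fst c \<inter> fst d)) (snd d \<circ> chart_inv c))"

definition chart_smooth_on ::
    "('a, 'm::finite) chart \<Rightarrow> 'a set \<Rightarrow> ('a \<Rightarrow> 'b::real_normed_vector) \<Rightarrow> bool" where
  "chart_smooth_on c U f \<longleftrightarrow> smooth_on (snd c ` (U \<inter> fst c)) (f \<circ> chart_inv c)"

definition smooth_fun_on ::
    "('a, 'm::finite) chart set \<Rightarrow> 'a set \<Rightarrow> ('a \<Rightarrow> complex) \<Rightarrow> bool" where
  "smooth_fun_on A U f \<longleftrightarrow> (\<forall>c\<in>A. chart_smooth_on c U f)"

text \<open>The partial derivative of \<open>f\<close> with respect to the \<open>i\<close>-th coordinate of the chart \<open>c\<close>.\<close>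

definition chart_pd ::
    "('a, 'm::finite) chart \<Rightarrow> 'm \<Rightarrow> ('a \<Rightarrow> 'b::real_normed_vector) \<Rightarrow> 'a \<Rightarrow> 'b" where
  "chart_pd c i f p = frechet_derivative (f \<circ> chart_inv c) (at (snd c p)) (axis i 1)"

definition jacobian ::
    "('a, 'm::finite) chart \<Rightarrow> ('a, 'm) chart \<Rightarrow> 'a \<Rightarrow> real^'m^'m" where
  "jacobian c d p = matrix (frechet_derivative (snd d \<circ> chart_inv c) (at (snd c p)))"


section \<open>Vector fields and 1-forms\<close>

text \<open>
  A tangent vector at \<open>p\<close> is given by its components in all charts around \<open>p\<close>, which transform
  with the Jacobian; so \<open>X c p\<close> is the vector of components in the chart \<open>c\<close> of the vector field
  \<open>X\<close> at \<open>p\<close>. Vector fields have complex coefficients. Where \<open>c\<close> is not a chart around \<open>p\<close> the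
  value is required to be 0, so that vector fields with the same components are equal.
\<close>

type_synonym ('a, 'm) vfield = "('a, 'm) chart \<Rightarrow> 'a \<Rightarrow> complex^'m"

definition Vect :: "('a, 'm::finite) chart set \<Rightarrow> ('a, 'm) vfield set" where
  "Vect A = {X.
     (\<forall>c\<in>A. \<forall>d\<in>A. \<forall>p\<in>fst c \<inter> fst d. X d p = map_matrix of_real (jacobian c d p) *v X c p) \<and>
     (\<forall>c\<in>A. chart_smooth_on c UNIV (X c)) \<and>
     (\<forall>c p. \<not> (c \<in> A \<and> p \<in> fst c) \<longrightarrow> X c p = 0)}"

definition lie_bracket ::
    "('a, 'm::finite) chart set \<Rightarrow> ('a, 'm) vfield \<Rightarrow> ('a, 'm) vfield \<Rightarrow> ('a, 'm) vfield" where
  "lie_bracket A X Y c p =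
     (if c \<in> A \<and> p \<in> fst c
      then \<chi> i. \<Sum>j\<in>UNIV. X c p $ j * chart_pd c j (\<lambda>q. Y c q $ i) p
                       - Y c p $ j * chart_pd c j (\<lambda>q. X c q $ i) p
      else 0)"

text \<open>
  Likewise \<open>\<alpha> c p\<close> is the vector of components in the chart \<open>c\<close> of a real 1-form on an open set
  \<open>U\<close>; its values outside \<open>U\<close> are irrelevant.
\<close>

type_synonym ('a, 'm) form1 = "('a, 'm) chart \<Rightarrow> 'a \<Rightarrow> real^'m"

definition one_form_on ::
    "('a::topological_space, 'm::finite) chart set \<Rightarrow> 'a set \<Rightarrow> ('a, 'm) form1 \<Rightarrow> bool" where
  "one_form_on A U \<alpha> \<longleftrightarrow> open U \<and>
     (\<forall>c\<in>A. \<forall>d\<in>A. \<forall>p\<in>U \<inter> fst c \<inter> fst d. \<alpha> c p = transpose (jacobian c d p) *v \<alpha> d p) \<and>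
     (\<forall>c\<in>A. chart_smooth_on c U (\<alpha> c))"

text \<open>The function \<open>\<alpha>(X)\<close>, computed at \<open>p\<close> in the chart \<open>c\<close>.\<close>

definition form_apply ::
    "('a, 'm::finite) form1 \<Rightarrow> ('a, 'm) vfield \<Rightarrow> ('a, 'm) chart \<Rightarrow> 'a \<Rightarrow> complex" where
  "form_apply \<alpha> X c p = (\<Sum>i\<in>UNIV. of_real (\<alpha> c p $ i) * X c p $ i)"

text \<open>
  The components \<open>(d\<alpha>)\<^sub>i\<^sub>j = \<partial>\<^sub>i \<alpha>\<^sub>j - \<partial>\<^sub>j \<alpha>\<^sub>i\<close>, that is, the normalization without the factor 1/2:
  \<open>d\<alpha>(X, Y) = X (\<alpha>(Y)) - Y (\<alpha>(X)) - \<alpha>([X, Y])\<close>.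
\<close>

definition ext_deriv ::
    "('a, 'm::finite) form1 \<Rightarrow> ('a, 'm) chart \<Rightarrow> 'a \<Rightarrow> real^'m^'m" where
  "ext_deriv \<alpha> c p =
     (\<chi> i j. chart_pd c i (\<lambda>q. \<alpha> c q $ j) p - chart_pd c j (\<lambda>q. \<alpha> c q $ i) p)"

definition ext_deriv_apply ::
    "('a, 'm::finite) form1 \<Rightarrow> ('a, 'm) vfield \<Rightarrow> ('a, 'm) vfield \<Rightarrow> ('a, 'm) chart \<Rightarrow> 'a \<Rightarrow> complex"
  where
  "ext_deriv_apply \<alpha> X Y c p =
     (\<Sum>i\<in>UNIV. \<Sum>j\<in>UNIV. of_real (ext_deriv \<alpha> c p $ i $ j) * X c p $ i * Y c p $ j)"

text \<open>
  The components of the Lie derivative \<open>L\<^sub>X \<alpha>\<close>, which is characterized by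
  \<open>(L\<^sub>X \<alpha>)(Y) = X (\<alpha>(Y)) - \<alpha>([X, Y])\<close>.
\<close>

definition lie_deriv ::
    "('a, 'm::finite) vfield \<Rightarrow> ('a, 'm) form1 \<Rightarrow> ('a, 'm) chart \<Rightarrow> 'a \<Rightarrow> complex^'m" where
  "lie_deriv X \<alpha> c p =
     (\<chi> j. \<Sum>i\<in>UNIV. X c p $ i * of_real (chart_pd c i (\<lambda>q. \<alpha> c q $ j) p)
                  + of_real (\<alpha> c p $ i) * chart_pd c j (\<lambda>q. X c q $ i) p)"


section \<open>Exterior products of alternating forms on a vector space\<close>

text \<open>
  A \<open>k\<close>-form on a vector space is represented as a function of the sequence of its arguments,
  of which only the first \<open>k\<close> matter.
\<close>

definition wedge ::
    "nat \<Rightarrow> nat \<Rightarrow> ((nat \<Rightarrow> 'v) \<Rightarrow> real) \<Rightarrow> ((nat \<Rightarrow> 'v) \<Rightarrow> real) \<Rightarrow> (nat \<Rightarrow> 'v) \<Rightarrow> real" where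
  "wedge k l a b v =
     (\<Sum>\<sigma> | \<sigma> permutes {..<k + l}.
        of_int (sign \<sigma>) * a (\<lambda>i. v (\<sigma> i)) * b (\<lambda>i. v (\<sigma> (k + i)))) / (fact k * fact l)"

primrec wedge_power ::
    "nat \<Rightarrow> ((nat \<Rightarrow> 'v) \<Rightarrow> real) \<Rightarrow> nat \<Rightarrow> (nat \<Rightarrow> 'v) \<Rightarrow> real" where
  "wedge_power k a 0 = (\<lambda>v. 1)"
| "wedge_power k a (Suc n) = wedge k (n * k) a (wedge_power k a n)"

text \<open>The \<open>(2n+1)\<close>-form \<open>\<alpha> \<and> (d\<alpha>)\<^sup>n\<close> at \<open>p\<close> in the chart \<open>c\<close>.\<close>

definition contact_volume ::
    "nat \<Rightarrow> ('a, 'm::finite) form1 \<Rightarrow> ('a, 'm) chart \<Rightarrow> 'a \<Rightarrow> (nat \<Rightarrow> real^'m) \<Rightarrow> real" where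
  "contact_volume n \<alpha> c p =
     wedge 1 (n * 2) (\<lambda>v. \<alpha> c p \<bullet> v 0)
       (wedge_power 2 (\<lambda>v. v 0 \<bullet> (ext_deriv \<alpha> c p *v v 1)) n)"


section \<open>Contact structures\<close>

text \<open>
  \<open>\<xi> c p\<close> is the subspace \<open>\<xi>\<close> of the (real) tangent space at \<open>p\<close>, in the components of the chart
  \<open>c\<close>. A contact form on \<open>U\<close> is real, so \<open>\<xi>\<close> has codimension 1 on \<open>U\<close>.
\<close>

type_synonym ('a, 'm) distribution = "('a, 'm) chart \<Rightarrow> 'a \<Rightarrow> (real^'m) set"

definition contact_form_on ::
    "('a::topological_space, 'm::finite) chart set \<Rightarrow> nat \<Rightarrow> ('a, 'm) distribution \<Rightarrow>
      'a set \<Rightarrow> ('a, 'm) form1 \<Rightarrow> bool" where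
  "contact_form_on A n \<xi> U \<alpha> \<longleftrightarrow> one_form_on A U \<alpha> \<and>
     (\<forall>c\<in>A. \<forall>p\<in>U \<inter> fst c. \<xi> c p = {v. \<alpha> c p \<bullet> v = 0} \<and> (\<exists>v. contact_volume n \<alpha> c p v \<noteq> 0))"

definition contact_structure ::
    "('a::topological_space, 'm::finite) chart set \<Rightarrow> nat \<Rightarrow> ('a, 'm) distribution \<Rightarrow> bool" where
  "contact_structure A n \<xi> \<longleftrightarrow> (\<forall>p. \<exists>U \<alpha>. p \<in> U \<and> contact_form_on A n \<xi> U \<alpha>)"

definition CVect ::
    "('a::topological_space, 'm::finite) chart set \<Rightarrow> nat \<Rightarrow> ('a, 'm) distribution \<Rightarrow>
      ('a, 'm) vfield set" where
  "CVect A n \<xi> = {X \<in> Vect A. \<forall>U \<alpha>. contact_form_on A n \<xi> U \<alpha> \<longrightarrow>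
     (\<exists>f. smooth_fun_on A U f \<and>
        (\<forall>c\<in>A. \<forall>p\<in>U \<inter> fst c. \<forall>j. lie_deriv X \<alpha> c p $ j = f p * of_real (\<alpha> c p $ j)))}"

definition TVect ::
    "('a::topological_space, 'm::finite) chart set \<Rightarrow> nat \<Rightarrow> ('a, 'm) distribution \<Rightarrow>
      ('a, 'm) vfield set" where
  "TVect A n \<xi> = {X \<in> Vect A. \<forall>U \<alpha>. contact_form_on A n \<xi> U \<alpha> \<longrightarrow>
     (\<forall>c\<in>A. \<forall>p\<in>U \<inter> fst c. form_apply \<alpha> X c p = 0)}"

text \<open>\<open>H\<^bsub>X,Y\<^esub> = i\<^sub>X i\<^sub>Y d\<alpha>\<close>; note the order of the arguments.\<close>

definition H_fun ::
    "('a, 'm::finite) form1 \<Rightarrow> ('a, 'm) vfield \<Rightarrow> ('a, 'm) vfield \<Rightarrow> ('a, 'm) chart \<Rightarrow> 'a \<Rightarrow> complex"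
  where
  "H_fun \<alpha> X Y c p = ext_deriv_apply \<alpha> Y X c p"

text \<open>
  The contact vector field whose contact Hamiltonian with respect to every local contact form
  \<open>\<alpha>\<close> is \<open>H\<^bsub>X,Y\<^esub>\<close>.
\<close>

definition contact_B ::
    "('a::topological_space, 'm::finite) chart set \<Rightarrow> nat \<Rightarrow> ('a, 'm) distribution \<Rightarrow>
      ('a, 'm) vfield \<Rightarrow> ('a, 'm) vfield \<Rightarrow> ('a, 'm) vfield" where
  "contact_B A n \<xi> X Y = (THE B. B \<in> CVect A n \<xi> \<and>
     (\<forall>U \<alpha>. contact_form_on A n \<xi> U \<alpha> \<longrightarrow>
        (\<forall>c\<in>A. \<forall>p\<in>U \<inter> fst c. form_apply \<alpha> B c p = H_fun \<alpha> X Y c p)))"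

end

theory Submission
  imports Defs
begin

text \<open>
  For \<open>X\<close>, \<open>Y\<close> tangent to \<open>\<xi>\<close> the formula \<open>d\<alpha>(Y, X) = Y (\<alpha>(X)) - X (\<alpha>(Y)) - \<alpha>([Y, X])\<close> gives
  \<open>\<alpha>([X, Y]) = H\<^bsub>X,Y\<^esub>\<close>, which is also \<open>\<alpha>(\<B>(X, Y))\<close>. The substance is that \<open>\<B>(X, Y)\<close> exists and
  is unique. Pointwise, a contact field \<open>B\<close> with Hamiltonian \<open>H\<close> and factor \<open>g\<close> solves the linear
  system \<open>\<alpha>(B) = H\<close>, \<open>i\<^sub>B d\<alpha> - g \<alpha> = - dH\<close> of \<open>2n + 2\<close> equations in the \<open>2n + 2\<close> unknowns \<open>(B, g)\<close>.
  A vector \<open>z\<close> with \<open>\<alpha>(z) = 0\<close> and \<open>i\<^sub>z d\<alpha> = g \<alpha>\<close> contracts \<open>\<alpha> \<and> (d\<alpha>)\<^sup>n\<close> to zero, hence vanishes;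
  so the system is regular, and Cramer's rule shows that the solution is smooth. It does not depend
  on the chart nor on the contact form, so the local solutions fit together.
\<close>

section \<open>The contact condition as nondegeneracy\<close>

text \<open>The identity \<alpha>([X, Y]) = H is a short calculation. The length comes from
  \<open>contact_B\<close> being a definite description: nothing is known about it until a contact
  field with Hamiltonian H has been constructed and shown to be the only one. The contact condition
  is stated as a sum over permutations of 2n + 1 arguments, and nondegeneracy of d\<alpha> on ker
  \<alpha> has to be extracted from that sum by pairing its terms. Taking the factor g as a further
  unknown makes the system square, so a trivial kernel already gives solvability; the coefficients
  are real while the fields are complex, so the kernel is examined by real and imaginary parts.
  Gluing has two dependences to exclude. Under \<alpha> -> f\<alpha> the field B stays and g becomes
  g + B(f)/f, provided that H scales by f; it does because df \<and> \<alpha>, the extra term of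
  d(f\<alpha>), vanishes on tangent X, Y. Under a change of chart B transforms as a vector and g is
  unchanged; here second derivatives of the transition maps appear and cancel by the symmetry of
  mixed partial derivatives.\<close>

definition alternation :: "nat \<Rightarrow> ((nat \<Rightarrow> 'v) \<Rightarrow> real) \<Rightarrow> (nat \<Rightarrow> 'v) \<Rightarrow> real" where
  "alternation n B v = (\<Sum>\<sigma> | \<sigma> permutes {..<n}. of_int (sign \<sigma>) * B (\<lambda>i. v (\<sigma> i)))"

text \<open>A form is represented on whole sequences of arguments; a k-form must ignore the entries
  from k on, so that permuting those does not affect it.\<close>

definition depends_on_first :: "nat \<Rightarrow> ((nat \<Rightarrow> 'v) \<Rightarrow> 'b) \<Rightarrow> bool" where
  "depends_on_first n B \<longleftrightarrow> (\<forall>u w. (\<forall>i<n. u i = w i) \<longrightarrow> B u = B w)"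

text \<open>A permutation \<tau> of the last l arguments is absorbed into the outer permutation
  \<sigma>: as \<sigma> runs through all permutations, so does
  \<open>\<sigma> \<circ> sh \<tau>\<close>, where \<open>sh \<tau>\<close> is \<tau> moved to the
  block {k..<k+l}. The l! choices of \<tau> therefore contribute equally and cancel
  \<open>fact l\<close> in \<open>wedge\<close>.\<close>

lemma wedge_alternation:
  assumes a: "depends_on_first k a" and B: "depends_on_first l B"
  shows "wedge k l a (alternation l B) v =
    alternation (k + l) (\<lambda>u. a u * B (\<lambda>i. u (k + i))) v / fact k"
proof -
  define sh where "sh \<tau> = map_permutation {..<l} (\<lambda>i. k + i) \<tau>" for \<tau> :: "nat \<Rightarrow> nat"
  have inj: "inj_on (\<lambda>i. k + i) {..<l}" by (auto simp: inj_on_def)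
  have img: "(\<lambda>i. k + i) ` {..<l} = {k..<k+l}"
    by (auto simp: image_iff) (metis add.commute le_add_diff_inverse less_diff_conv2 lessThan_iff)
  have sh_perm: "sh \<tau> permutes {..<k+l}" if "\<tau> permutes {..<l}" for \<tau>
  proof -
    have "sh \<tau> permutes {k..<k+l}" unfolding sh_def
      by (rule map_permutation_permutes[OF _ that]) (use inj img in \<open>auto simp: bij_betw_def\<close>)
    then show ?thesis by (rule permutes_subset) auto
  qed
  have sh_lo: "sh \<tau> i = i" if "i < k" for \<tau> i
    unfolding sh_def map_permutation_def using that img by (simp add: restrict_id_def)
  have sh_hi: "sh \<tau> (k + i) = k + \<tau> i" if "i < l" for \<tau> i
    unfolding sh_def using map_permutation_apply[OF inj, of i \<tau>] that by simp
  have sh_sign: "sign (sh \<tau>) = sign \<tau>" if "\<tau> permutes {..<l}" for \<tau>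
    unfolding sh_def by (rule sign_map_permutation) (use inj that in auto)
  define G where "G = (\<lambda>u. a u * B (\<lambda>i. u (k + i)))"
  have eq: "of_int (sign \<sigma>) * a (\<lambda>i. v (\<sigma> i)) * (of_int (sign \<tau>) * B (\<lambda>i. v (\<sigma> (k + \<tau> i))))
      = of_int (sign (\<sigma> \<circ> sh \<tau>)) * G (\<lambda>i. v ((\<sigma> \<circ> sh \<tau>) i))"
    if s: "\<sigma> permutes {..<k+l}" and t: "\<tau> permutes {..<l}" for \<sigma> \<tau>
  proof -
    have "sign (\<sigma> \<circ> sh \<tau>) = sign \<sigma> * sign \<tau>"
      by (subst sign_compose) (use s sh_perm[OF t] sh_sign[OF t] in \<open>auto intro: permutation_permutes[THEN iffD2]\<close>)
    moreover have "a (\<lambda>i. v (\<sigma> i)) = a (\<lambda>i. v ((\<sigma> \<circ> sh \<tau>) i))"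
      using a unfolding depends_on_first_def by (auto simp: sh_lo)
    moreover have "B (\<lambda>i. v (\<sigma> (k + \<tau> i))) = B (\<lambda>i. v ((\<sigma> \<circ> sh \<tau>) (k + i)))"
      using B unfolding depends_on_first_def by (auto simp: sh_hi)
    ultimately show ?thesis by (simp add: G_def)
  qed
  have "wedge k l a (alternation l B) v * (fact k * fact l) =
     (\<Sum>\<sigma> | \<sigma> permutes {..<k + l}. of_int (sign \<sigma>) * a (\<lambda>i. v (\<sigma> i)) *
        (\<Sum>\<tau> | \<tau> permutes {..<l}. of_int (sign \<tau>) * B (\<lambda>i. v (\<sigma> (k + \<tau> i)))))"
    by (simp add: wedge_def alternation_def)
  also have "\<dots> = (\<Sum>\<sigma> | \<sigma> permutes {..<k + l}. \<Sum>\<tau> | \<tau> permutes {..<l}.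
        of_int (sign (\<sigma> \<circ> sh \<tau>)) * G (\<lambda>i. v ((\<sigma> \<circ> sh \<tau>) i)))"
    by (intro sum.cong refl, simp add: sum_distrib_left, intro sum.cong refl)
       (use eq in auto)
  also have "\<dots> = (\<Sum>\<tau> | \<tau> permutes {..<l}. \<Sum>\<sigma> | \<sigma> permutes {..<k + l}.
        of_int (sign (\<sigma> \<circ> sh \<tau>)) * G (\<lambda>i. v ((\<sigma> \<circ> sh \<tau>) i)))"
    by (rule sum.swap)
  also have "\<dots> = (\<Sum>\<tau> | \<tau> permutes {..<l}. alternation (k + l) G v)"
    unfolding alternation_def
    by (intro sum.cong refl sum_permutations_compose_right[symmetric] sh_perm) auto
  also have "\<dots> = fact l * alternation (k + l) G v"
    by (simp add: card_permutations[OF refl])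
  finally show ?thesis by (simp add: G_def field_simps)
qed

text \<open>\<open>wedge_power\<close> puts the new factor in front, so the induction peels off the
  arguments 0, 1 and shifts the remaining pairs by 2. Each step contributes 1/2! and no other
  constant, whence 2^n.\<close>

lemma wedge_power_two:
  fixes D :: "real^'m::finite^'m"
  shows "wedge_power 2 (\<lambda>v. v 0 \<bullet> (D *v v 1)) n v =
    alternation (n * 2) (\<lambda>u. (\<Prod>j<n. u (2*j) \<bullet> (D *v u (2*j+1))) / 2 ^ n) v"
proof (induction n arbitrary: v)
  case 0
  show ?case by (simp add: alternation_def)
next
  case (Suc n)
  have 1: "(\<Prod>j<Suc n. u (2*j) \<bullet> (D *v u (2*j+1))) / 2 ^ Suc n =
    (u 0 \<bullet> (D *v u 1) * ((\<Prod>j<n. u (2 + 2*j) \<bullet> (D *v u (2 + (2*j+1)))) / 2 ^ n)) / fact 2"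
    for u :: "nat \<Rightarrow> real^'m"
    by (subst prod.lessThan_Suc_shift) (simp add: fact_2)
  have 2: "wedge_power 2 (\<lambda>v. v 0 \<bullet> (D *v v 1)) n =
    alternation (n * 2) (\<lambda>u. (\<Prod>j<n. u (2*j) \<bullet> (D *v u (2*j+1))) / 2 ^ n)"
    using Suc by blast
  show ?case unfolding wedge_power.simps 2
    apply (subst wedge_alternation)
    subgoal by (auto simp: depends_on_first_def)
    subgoal by (auto simp: depends_on_first_def intro!: prod.cong)
    subgoal unfolding 1 alternation_def by (simp add: sum_divide_distrib)
    done
qed

text \<open>The term of the identity permutation in \<alpha> \<and> (d\<alpha>)^n without its
  constant: slot 0 belongs to \<alpha>, slots 2j + 1 and 2j + 2 to the j-th factor
  d\<alpha>.\<close>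

definition volume_term :: "nat \<Rightarrow> real^'m \<Rightarrow> real^'m::finite^'m \<Rightarrow> (nat \<Rightarrow> real^'m) \<Rightarrow> real" where
  "volume_term n a D u = (a \<bullet> u 0) * (\<Prod>j<n. u (2*j+1) \<bullet> (D *v u (2*j+2)))"

text \<open>The factor \<alpha> in front moves the argument pairs of (d\<alpha>)^n up by one slot
  and divides by 1! only, so 2^n is the one remaining constant.\<close>

lemma contact_volume_alternation:
  "contact_volume n \<alpha> c p v =
     alternation (2*n+1) (volume_term n (\<alpha> c p) (ext_deriv \<alpha> c p)) v / 2 ^ n"
proof -
  let ?D = "ext_deriv \<alpha> c p"
  have 1: "wedge_power 2 (\<lambda>v. v 0 \<bullet> (?D *v v 1)) n =
    alternation (n * 2) (\<lambda>u. (\<Prod>j<n. u (2*j) \<bullet> (?D *v u (2*j+1))) / 2 ^ n)"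
    using wedge_power_two by blast
  show ?thesis
    unfolding contact_volume_def 1
    apply (subst wedge_alternation)
    subgoal by (auto simp: depends_on_first_def)
    subgoal by (auto simp: depends_on_first_def intro!: prod.cong)
    subgoal by (simp add: alternation_def volume_term_def sum_divide_distrib mult.commute)
    done
qed

section \<open>Alternating multilinear forms and contraction with a vector\<close>

lemma alternation_eq_args:
  assumes "i < n" "j < n" "i \<noteq> j" "v i = v j"
  shows "alternation n B v = 0"
proof -
  let ?t = "Transposition.transpose i j"
  have t: "?t permutes {..<n}" using assms by (intro permutes_swap_id) auto
  \<comment> \<open>Composition with the transposition permutes the terms and reverses their signs,
    but leaves the arguments unchanged because v i = v j; so the sum is its own negative.\<close>
  have "alternation n B v =
    (\<Sum>\<sigma> | \<sigma> permutes {..<n}. of_int (sign (?t \<circ> \<sigma>)) * B (\<lambda>k. v ((?t \<circ> \<sigma>) k)))"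
    unfolding alternation_def by (rule setum_permutations_compose_left[OF t])
  also have "\<dots> = (\<Sum>\<sigma> | \<sigma> permutes {..<n}. - (of_int (sign \<sigma>) * B (\<lambda>k. v (\<sigma> k))))"
  proof (intro sum.cong refl)
    fix \<sigma> assume "\<sigma> \<in> {\<sigma>. \<sigma> permutes {..<n}}"
    then have "sign (?t \<circ> \<sigma>) = - sign \<sigma>"
      by (subst sign_compose) (use t assms in \<open>auto simp: sign_swap_id intro: permutation_permutes[THEN iffD2]\<close>)
    moreover have "v (?t k) = v k" for k using assms(4) by (auto simp: Transposition.transpose_def)
    ultimately show "of_int (sign (?t \<circ> \<sigma>)) * B (\<lambda>k. v ((?t \<circ> \<sigma>) k)) = - (of_int (sign \<sigma>) * B (\<lambda>k. v (\<sigma> k)))"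
      by simp
  qed
  also have "\<dots> = - alternation n B v" by (simp add: alternation_def sum_negf)
  finally show ?thesis by simp
qed

lemma volume_term_linear:
  assumes "k < 2*n+1"
  shows "linear (\<lambda>x. volume_term n a D (u(k := x)))"
proof (cases "k = 0")
  case True
  have "(\<lambda>x. volume_term n a D (u(k := x))) = (\<lambda>x. (\<Prod>j<n. u (2*j+1) \<bullet> (D *v u (2*j+2))) *\<^sub>R (a \<bullet> x))"
    using True by (auto simp: volume_term_def)
  then show ?thesis
    by (simp only:) (intro linear_compose_scale_right bounded_linear.linear bounded_linear_inner_right)
next
  case False
  \<comment> \<open>Slot k > 0 lies in exactly one pair, the i-th; all other factors stay constant
    when the entry there changes.\<close>
  define i where "i = (k - 1) div 2"
  have i: "i < n" using assms False unfolding i_def by auto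
  have k: "k = 2*i+1 \<or> k = 2*i+2" using False unfolding i_def by presburger
  define C where "C = (a \<bullet> u 0) * (\<Prod>j\<in>{..<n}-{i}. u (2*j+1) \<bullet> (D *v u (2*j+2)))"
  have ne: "2*j+1 \<noteq> k" "2*j+2 \<noteq> k" if "j \<noteq> i" for j using k that by presburger+
  have "volume_term n a D (u(k := x)) = C * ((u(k:=x)) (2*i+1) \<bullet> (D *v (u(k:=x)) (2*i+2)))" for x
  proof -
    have "(\<Prod>j\<in>{..<n}-{i}. (u(k:=x)) (2*j+1) \<bullet> (D *v (u(k:=x)) (2*j+2))) =
      (\<Prod>j\<in>{..<n}-{i}. u (2*j+1) \<bullet> (D *v u (2*j+2)))"
      by (rule prod.cong) (use ne in auto)
    then show ?thesis unfolding volume_term_def C_def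
      using i False by (subst prod.remove[of _ i]) auto
  qed
  moreover have "linear (\<lambda>x. C * ((u(k:=x)) (2*i+1) \<bullet> (D *v (u(k:=x)) (2*i+2))))"
    using k by (auto intro!: linearI simp: inner_add_left inner_add_right matrix_vector_right_distrib algebra_simps matrix_vector_mult_scaleR)
  ultimately show ?thesis by simp
qed

text \<open>Replacing entry k of v before permuting by \<sigma> amounts to replacing slot
  \<open>inv \<sigma> k\<close> afterwards, so linearity of the single terms carries over.\<close>

lemma alternation_volume_linear:
  assumes "k < 2*n+1"
  shows "linear (\<lambda>x. alternation (2*n+1) (volume_term n a D) (v(k := x)))"
proof -
  have "linear (\<lambda>x. of_int (sign \<sigma>) * volume_term n a D (\<lambda>i. (v(k := x)) (\<sigma> i)))"
    if s: "\<sigma> permutes {..<2*n+1}" for \<sigma>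
  proof -
    have "(\<lambda>i. (v(k := x)) (\<sigma> i)) = (\<lambda>i. v (\<sigma> i))(inv \<sigma> k := x)" for x
      using permutes_inverses[OF s] by (auto simp: fun_eq_iff)
    moreover have "inv \<sigma> k < 2*n+1"
      using permutes_in_image[OF permutes_inv[OF s], of k] assms by simp
    then have "linear (\<lambda>x. volume_term n a D ((\<lambda>i. v (\<sigma> i))(inv \<sigma> k := x)))"
      by (rule volume_term_linear)
    then have "linear (\<lambda>x. of_int (sign \<sigma>) *\<^sub>R volume_term n a D ((\<lambda>i. v (\<sigma> i))(inv \<sigma> k := x)))"
      by (rule linear_compose_scale_right)
    ultimately show ?thesis by simp
  qed
  then show ?thesis unfolding alternation_def by (intro linear_compose_sum) auto
qed

text \<open>Steinitz exchange: where the alternating form does not vanish, the 2n + 1 arguments are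
  linearly independent, hence a basis by the dimension count. Replacing one basis vector by z
  multiplies the value by the corresponding coordinate of z, and some coordinate is nonzero.\<close>

lemma alternation_volume_replace:
  fixes v :: "nat \<Rightarrow> real^'m::finite"
  assumes card: "CARD('m) = 2*n+1" and nz: "alternation (2*n+1) (volume_term n a D) v \<noteq> 0" and z: "z \<noteq> 0"
  obtains i w where "i < 2*n+1" "w i = z" "alternation (2*n+1) (volume_term n a D) w \<noteq> 0"
proof -
  let ?P = "alternation (2*n+1) (volume_term n a D)"
  obtain e :: "'m \<Rightarrow> nat" where e: "bij_betw e UNIV {..<2*n+1}"
    using card by (metis bij_betw_iff_card card_lessThan finite finite_lessThan)
  have el: "e k < 2*n+1" for k using e by (auto simp: bij_betw_def)
  have einj: "e k = e l \<longleftrightarrow> k = l" for k l using e by (auto simp: bij_betw_def inj_on_def)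
  define L :: "real^'m \<Rightarrow> real^'m" where "L c = (\<Sum>k\<in>UNIV. c $ k *\<^sub>R v (e k))" for c
  have L: "linear L" unfolding L_def
    by (intro linearI) (simp_all add: scaleR_left_distrib sum.distrib scaleR_sum_right)
  \<comment> \<open>Cramer's rule: all terms of the expansion but the k-th repeat an argument and
    vanish.\<close>
  have key: "?P (v(e k := L c)) = c $ k * ?P v" for c k
  proof -
    have lin: "linear (\<lambda>x. ?P (v(e k := x)))" by (rule alternation_volume_linear) (rule el)
    have "?P (v(e k := L c)) = (\<Sum>l\<in>UNIV. c $ l * ?P (v(e k := v (e l))))"
      unfolding L_def using linear_sum[OF lin, of "\<lambda>l. c $ l *\<^sub>R v (e l)" UNIV] linear_scale[OF lin] by simp
    also have "\<dots> = (\<Sum>l\<in>UNIV. if l = k then c $ k * ?P v else 0)"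
    proof (intro sum.cong refl)
      fix l
      show "c $ l * ?P (v(e k := v (e l))) = (if l = k then c $ k * ?P v else 0)"
      proof (cases "l = k")
        case False
        then have "?P (v(e k := v (e l))) = 0"
          by (intro alternation_eq_args[of "e k" _ "e l"]) (use el einj in auto)
        then show ?thesis using False by simp
      qed simp
    qed
    also have "\<dots> = c $ k * ?P v" by simp
    finally show ?thesis .
  qed
  have "c = 0" if "L c = 0" for c
  proof -
    have "c $ k * ?P v = 0" for k
    proof -
      have "linear (\<lambda>x. ?P (v(e k := x)))" by (rule alternation_volume_linear) (rule el)
      from linear_0[OF this] show ?thesis using key[of k c] that by simp
    qed
    then show ?thesis using nz by (simp add: vec_eq_iff)
  qed
  then have "surj L"
    using L by (intro linear_injective_imp_surjective) (auto simp: linear_injective_0)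
  then obtain c where c: "L c = z" by (metis surjD)
  have "c \<noteq> 0" using c z linear_0[OF L] by auto
  then obtain k where "c $ k \<noteq> 0" by (auto simp: vec_eq_iff)
  then show thesis using key[of k c] c nz el[of k] that[of "e k" "v(e k := z)"] by auto
qed

text \<open>With z in slot p, its factor d\<alpha> equals g \<alpha>(u_q) up to sign, q being the
  partner slot of p. Multiplied by \<alpha>(u_0) this is symmetric in u_0 and u_q, and no other
  factor contains either of them.\<close>

lemma volume_term_swap:
  assumes anti: "transpose D = - D" and z: "u p = z" "a \<bullet> z = 0" "\<And>x. z \<bullet> (D *v x) = g * (a \<bullet> x)"
    and p: "p < 2*n+1" "p \<noteq> 0"
  defines "q \<equiv> if odd p then p + 1 else p - 1"
  shows "volume_term n a D (\<lambda>i. u (Transposition.transpose 0 q i)) = volume_term n a D u"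
proof -
  have z': "x \<bullet> (D *v z) = - g * (a \<bullet> x)" for x
  proof -
    have "x \<bullet> (D *v z) = (x v* D) \<bullet> z" by (rule dot_lmul_matrix[symmetric])
    also have "\<dots> = (transpose D *v x) \<bullet> z" by simp
    also have "\<dots> = - (z \<bullet> (D *v x))" unfolding anti
      by (simp add: inner_vec_def matrix_vector_mult_def sum_negf mult.commute)
    finally show ?thesis using z(3) by simp
  qed
  define i where "i = (p - 1) div 2"
  have i: "i < n" using p unfolding i_def by auto
  have k: "p = 2*i+1 \<and> q = 2*i+2 \<or> p = 2*i+2 \<and> q = 2*i+1" using p unfolding i_def q_def by presburger
  let ?u = "\<lambda>i. u (Transposition.transpose 0 q i)"
  have pr: "(\<Prod>j\<in>{..<n}-{i}. ?u (2*j+1) \<bullet> (D *v ?u (2*j+2))) =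
      (\<Prod>j\<in>{..<n}-{i}. u (2*j+1) \<bullet> (D *v u (2*j+2)))"
  proof (rule prod.cong)
    fix j assume "j \<in> {..<n} - {i}"
    then have "j \<noteq> i" by simp
    with k have "2*j+1 \<noteq> q \<and> 2*j+2 \<noteq> q" by presburger
    then show "?u (2*j+1) \<bullet> (D *v ?u (2*j+2)) = u (2*j+1) \<bullet> (D *v u (2*j+2))"
      by (simp add: Transposition.transpose_def)
  qed simp
  have sp: "volume_term n a D w = (a \<bullet> w 0) * (w (2*i+1) \<bullet> (D *v w (2*i+2))) *
    (\<Prod>j\<in>{..<n}-{i}. w (2*j+1) \<bullet> (D *v w (2*j+2)))" for w
    unfolding volume_term_def using i by (subst prod.remove[of _ i]) auto
  have "(a \<bullet> ?u 0) * (?u (2*i+1) \<bullet> (D *v ?u (2*i+2))) = (a \<bullet> u 0) * (u (2*i+1) \<bullet> (D *v u (2*i+2)))"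
    using k z z' by (auto simp: Transposition.transpose_def)
  then show ?thesis unfolding sp pr by simp
qed

text \<open>Contracting \<open>\<alpha> \<and> (d\<alpha>)\<^sup>n\<close> with \<open>z\<close> gives a multiple of \<open>\<alpha> \<and> \<alpha> \<and> (d\<alpha>)\<^bsup>n-1\<^esup>\<close>;
  on the level of permutations, exchanging the two arguments of \<open>\<alpha>\<close> cancels the terms in pairs.\<close>

lemma alternation_volume_eq_0:
  fixes a :: "real^'m::finite"
  assumes anti: "transpose D = - D" and z: "a \<bullet> z = 0" "\<And>x. z \<bullet> (D *v x) = g * (a \<bullet> x)"
    and i: "i < 2*n+1" "w i = z"
  shows "alternation (2*n+1) (volume_term n a D) w = 0"
proof -
  let ?S = "{\<sigma>. \<sigma> permutes {..<2*n+1}}"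
  let ?T = "\<lambda>\<sigma>. of_int (sign \<sigma>) * volume_term n a D (\<lambda>k. w (\<sigma> k))"
  have fin: "finite ?S" by (rule finite_permutations) simp
  \<comment> \<open>The terms are grouped by the slot p into which \<sigma> puts the argument z.
    Slot 0 contributes \<alpha>(z) = 0. For every other p the exchange of slots 0 and q leaves z in
    slot p, so it acts within the group, where it reverses signs.\<close>
  have "(\<Sum>\<sigma>\<in>?S. ?T \<sigma>) = (\<Sum>p\<in>{..<2*n+1}. \<Sum>\<sigma>\<in>{\<sigma>\<in>?S. inv \<sigma> i = p}. ?T \<sigma>)"
    by (rule sum.group[symmetric])
       (use i fin in \<open>auto simp: permutes_in_image[OF permutes_inv] simp flip: lessThan_iff\<close>)
  also have "\<dots> = 0"
  proof (rule sum.neutral, rule ballI)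
    fix p assume p: "p \<in> {..<2*n+1}"
    let ?Sp = "{\<sigma>\<in>?S. inv \<sigma> i = p}"
    have sp: "\<sigma> p = i" if "\<sigma> \<in> ?Sp" for \<sigma> using that permutes_inverses by force
    show "(\<Sum>\<sigma>\<in>?Sp. ?T \<sigma>) = 0"
    proof (cases "p = 0")
      case True
      then show ?thesis using sp z i by (intro sum.neutral) (auto simp: volume_term_def)
    next
      case False
      define q where "q = (if odd p then p + 1 else p - 1)"
      have q: "q < 2*n+1" "q \<noteq> 0" "q \<noteq> p" using p False unfolding q_def by (auto, presburger+)
      let ?t = "Transposition.transpose 0 q"
      have t: "?t permutes {..<2*n+1}" using q by (intro permutes_swap_id) auto
      have mem: "\<sigma> \<circ> ?t \<in> ?Sp" if "\<sigma> \<in> ?Sp" for \<sigma>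
      proof -
        have s: "\<sigma> \<circ> ?t permutes {..<2*n+1}" using that t by (auto intro: permutes_compose)
        moreover have "(\<sigma> \<circ> ?t) p = i" using sp[OF that] False q by (simp add: Transposition.transpose_def)
        ultimately show ?thesis using permutes_inv_eq[OF s] by auto
      qed
      have "(\<Sum>\<sigma>\<in>?Sp. ?T \<sigma>) = (\<Sum>\<sigma>\<in>?Sp. - ?T \<sigma>)"
      proof (rule sum.reindex_bij_witness[of _ "\<lambda>\<sigma>. \<sigma> \<circ> ?t" "\<lambda>\<sigma>. \<sigma> \<circ> ?t"])
        fix \<sigma> assume s: "\<sigma> \<in> ?Sp"
        show "\<sigma> \<circ> ?t \<circ> ?t = \<sigma>" by (simp add: o_assoc[symmetric])
        show "\<sigma> \<circ> ?t \<in> ?Sp" using mem[OF s] .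
        have "sign (\<sigma> \<circ> ?t) = - sign \<sigma>"
          by (subst sign_compose) (use s t q in \<open>auto simp: sign_swap_id intro: permutation_permutes[THEN iffD2]\<close>)
        moreover have "volume_term n a D (\<lambda>k. w (\<sigma> (?t k))) = volume_term n a D (\<lambda>k. w (\<sigma> k))"
          unfolding q_def
          by (rule volume_term_swap[OF anti, of "\<lambda>k. w (\<sigma> k)" p z]) (use sp[OF s] i z p False in auto)
        ultimately show "- ?T (\<sigma> \<circ> ?t) = ?T \<sigma>" by simp
      next
        fix \<sigma> assume s: "\<sigma> \<in> ?Sp"
        show "\<sigma> \<circ> ?t \<circ> ?t = \<sigma>" by (simp add: o_assoc[symmetric])
        show "\<sigma> \<circ> ?t \<in> ?Sp" using mem[OF s] .
      qed
      then show ?thesis by (simp add: sum_negf)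
    qed
  qed
  finally show ?thesis by (simp add: alternation_def)
qed

text \<open>This says that d\<alpha> is nondegenerate on ker \<alpha>, because a covector vanishes
  on ker \<alpha> exactly if it is a multiple g \<alpha>. With g explicit, the condition has the
  shape of the homogeneous system for (B, g).\<close>

definition contact_nondegenerate :: "real^'m::finite \<Rightarrow> real^'m^'m \<Rightarrow> bool" where
  "contact_nondegenerate a D \<longleftrightarrow> a \<noteq> 0 \<and>
     (\<forall>z g. a \<bullet> z = 0 \<and> (\<forall>j. (\<Sum>i\<in>UNIV. z $ i * D $ i $ j) = g * a $ j) \<longrightarrow> z = 0)"

text \<open>A nonzero z violating the condition could be exchanged for one of the arguments on which
  the volume is nonzero, but the volume vanishes whenever z is among its arguments.\<close>

lemma contact_nondegenerateI:
  fixes \<alpha> :: "('a, 'm::finite) form1"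
  assumes card: "CARD('m) = 2*n+1" and v: "contact_volume n \<alpha> c p v \<noteq> 0"
  shows "contact_nondegenerate (\<alpha> c p) (ext_deriv \<alpha> c p)"
  unfolding contact_nondegenerate_def
proof (intro conjI allI impI)
  let ?a = "\<alpha> c p" and ?D = "ext_deriv \<alpha> c p"
  have nz: "alternation (2*n+1) (volume_term n ?a ?D) v \<noteq> 0"
    using v unfolding contact_volume_alternation by simp
  then show "\<alpha> c p \<noteq> 0" by (auto simp: alternation_def volume_term_def)
  fix z g
  assume "?a \<bullet> z = 0 \<and> (\<forall>j. (\<Sum>i\<in>UNIV. z $ i * ?D $ i $ j) = g * ?a $ j)"
  then have az: "?a \<bullet> z = 0" and zD: "\<And>j. (\<Sum>i\<in>UNIV. z $ i * ?D $ i $ j) = g * ?a $ j" by auto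
  have anti: "transpose ?D = - ?D" by (simp add: vec_eq_iff Finite_Cartesian_Product.transpose_def ext_deriv_def)
  have zx: "z \<bullet> (?D *v x) = g * (?a \<bullet> x)" for x
  proof -
    have "z \<bullet> (?D *v x) = (\<Sum>j\<in>UNIV. (\<Sum>i\<in>UNIV. z $ i * ?D $ i $ j) * x $ j)"
      unfolding inner_vec_def matrix_vector_mult_def
      by (simp add: sum_distrib_left sum_distrib_right mult.assoc) (rule sum.swap)
    then show ?thesis unfolding zD by (simp add: inner_vec_def sum_distrib_left mult.assoc)
  qed
  show "z = 0"
  proof (rule ccontr)
    assume "z \<noteq> 0"
    then obtain i w where "i < 2*n+1" "w i = z" "alternation (2*n+1) (volume_term n ?a ?D) w \<noteq> 0"
      by (rule alternation_volume_replace[OF card nz])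
    then show False using alternation_volume_eq_0[OF anti az zx] by blast
  qed
qed

section \<open>Smooth functions on open sets\<close>

lemma frechet_derivative_eqI: "(f has_derivative f') (at x) \<Longrightarrow> frechet_derivative f (at x) = f'"
  by (metis frechet_derivative_at)

lemma has_derivative_frechet:
  "f differentiable (at x) \<Longrightarrow> (f has_derivative frechet_derivative f (at x)) (at x)"
  using frechet_derivative_works by blast

text \<open>Since S is open, the derivative at a point of S depends only on the values on S. The
  closure properties under algebraic operations use this: there a formula for the derivative is
  known only at points of S.\<close>

lemma Ck_on_cong:
  assumes "open S" "\<And>x. x \<in> S \<Longrightarrow> f x = g x"
  shows "Ck_on k S f \<longleftrightarrow> Ck_on k S g"
  using assms(2)
proof (induction k arbitrary: f g)
  case 0
  show ?case unfolding Ck_on.simps by (rule continuous_on_cong) (use 0 in auto)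
next
  case (Suc k)
  have "Ck_on (Suc k) S g" if eq: "\<And>x. x \<in> S \<Longrightarrow> f x = g x" and f: "Ck_on (Suc k) S f" for f g :: "'a \<Rightarrow> 'b"
  proof -
    have der: "(g has_derivative frechet_derivative f (at x)) (at x)" if "x \<in> S" for x
      by (rule has_derivative_transform_within_open[OF has_derivative_frechet \<open>open S\<close> that])
         (use f eq that in auto)
    have *: "frechet_derivative g (at x) = frechet_derivative f (at x)" if "x \<in> S" for x
      by (rule frechet_derivative_eqI) (rule der[OF that])
    have "Ck_on k S (\<lambda>x. frechet_derivative g (at x) v)" for v
      using Suc.IH[of "\<lambda>x. frechet_derivative g (at x) v" "\<lambda>x. frechet_derivative f (at x) v"] * f by simp
    then show ?thesis using der by (auto simp: differentiable_def)
  qed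
  from this[of f g, OF Suc.prems] this[of g f, OF Suc.prems[symmetric]] show ?case by blast
qed

lemma Ck_on_lower: "Ck_on (Suc k) S f \<Longrightarrow> Ck_on k S f"
proof (induction k arbitrary: f)
  case 0
  have "f differentiable_on S"
    by (rule differentiable_at_imp_differentiable_on) (use 0 in auto)
  then have "continuous_on S f" by (rule differentiable_imp_continuous_on)
  then show ?case by simp
next
  case (Suc k)
  show ?case unfolding Ck_on.simps(2)[of k S f] 
  proof (intro conjI allI)
    show "\<forall>x\<in>S. f differentiable at x" using Suc.prems unfolding Ck_on.simps(2)[of "Suc k" S f] by (rule conjunct1)
    fix v show "Ck_on k S (\<lambda>x. frechet_derivative f (at x) v)"
      using Suc.prems unfolding Ck_on.simps(2)[of "Suc k" S f] by (intro Suc.IH) (elim conjE allE)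
  qed
qed

lemma Ck_on_subset: "Ck_on k S f \<Longrightarrow> T \<subseteq> S \<Longrightarrow> Ck_on k T f"
proof (induction k arbitrary: f)
  case 0
  then show ?case by (auto intro: continuous_on_subset)
next
  case (Suc k)
  then show ?case by (simp add: subset_iff)
qed

lemma Ck_on_local:
  assumes "\<And>x. x \<in> S \<Longrightarrow> \<exists>T. open T \<and> x \<in> T \<and> Ck_on k T f"
  shows "Ck_on k S f"
  using assms
proof (induction k arbitrary: f)
  case 0
  have "isCont f x" if x: "x \<in> S" for x
  proof -
    obtain T where "open T" "x \<in> T" "Ck_on 0 T f" using 0[OF x] by blast
    then show ?thesis by (simp add: continuous_on_eq_continuous_at)
  qed
  then show ?case by (simp add: continuous_at_imp_continuous_on)
next
  case (Suc k)
  have "f differentiable (at x)" if x: "x \<in> S" for x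
  proof -
    obtain T where "x \<in> T" "Ck_on (Suc k) T f" using Suc.prems[OF x] by blast
    then show ?thesis by simp
  qed
  moreover have "Ck_on k S (\<lambda>x. frechet_derivative f (at x) v)" for v
  proof (rule Suc.IH)
    fix x assume "x \<in> S"
    then obtain T where "open T" "x \<in> T" "Ck_on (Suc k) T f" using Suc.prems by blast
    then show "\<exists>T. open T \<and> x \<in> T \<and> Ck_on k T (\<lambda>x. frechet_derivative f (at x) v)"
      by (intro exI[of _ T]) simp
  qed
  ultimately show ?case by simp
qed

lemma Ck_on_const: "Ck_on k S (\<lambda>x. c)"
  by (induction k arbitrary: c) auto

lemma Ck_on_linear:
  assumes "bounded_linear L" "open S"
  shows "Ck_on k S f \<Longrightarrow> Ck_on k S (\<lambda>x. L (f x))"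
proof (induction k arbitrary: f)
  case 0
  then show ?case using assms by (simp add: bounded_linear.continuous_on)
next
  case (Suc k)
  have der: "((\<lambda>x. L (f x)) has_derivative (\<lambda>v. L (frechet_derivative f (at x) v))) (at x)" if "x \<in> S" for x
    by (rule bounded_linear.has_derivative[OF assms(1) has_derivative_frechet]) (use Suc.prems that in auto)
  have "Ck_on k S (\<lambda>x. frechet_derivative (\<lambda>x. L (f x)) (at x) v)" for v
    using Suc.IH[of "\<lambda>x. frechet_derivative f (at x) v"] Suc.prems
    by (subst Ck_on_cong[OF \<open>open S\<close>]) (auto simp: frechet_derivative_eqI[OF der])
  then show ?case using der by (auto simp: differentiable_def)
qed

lemma Ck_on_add:
  assumes "open S"
  shows "Ck_on k S f \<Longrightarrow> Ck_on k S g \<Longrightarrow> Ck_on k S (\<lambda>x. f x + g x)"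
proof (induction k arbitrary: f g)
  case 0
  then show ?case by (simp add: continuous_on_add)
next
  case (Suc k)
  have der: "((\<lambda>x. f x + g x) has_derivative
      (\<lambda>v. frechet_derivative f (at x) v + frechet_derivative g (at x) v)) (at x)" if "x \<in> S" for x
    by (rule has_derivative_add[OF has_derivative_frechet has_derivative_frechet]) (use Suc.prems that in auto)
  have "Ck_on k S (\<lambda>x. frechet_derivative (\<lambda>x. f x + g x) (at x) v)" for v
    using Suc.IH[of "\<lambda>x. frechet_derivative f (at x) v" "\<lambda>x. frechet_derivative g (at x) v"] Suc.prems
    by (subst Ck_on_cong[OF \<open>open S\<close>]) (auto simp: frechet_derivative_eqI[OF der])
  then show ?case using der by (auto simp: differentiable_def)
qed

lemma Ck_on_mult:
  fixes f g :: "'e::real_normed_vector \<Rightarrow> 'b::real_normed_algebra"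
  assumes "open S"
  shows "Ck_on k S f \<Longrightarrow> Ck_on k S g \<Longrightarrow> Ck_on k S (\<lambda>x. f x * g x)"
proof (induction k arbitrary: f g)
  case 0
  then show ?case by (simp add: continuous_on_mult)
next
  case (Suc k)
  have der: "((\<lambda>x. f x * g x) has_derivative
      (\<lambda>v. f x * frechet_derivative g (at x) v + frechet_derivative f (at x) v * g x)) (at x)" if "x \<in> S" for x
    by (rule has_derivative_mult[OF has_derivative_frechet has_derivative_frechet]) (use Suc.prems that in auto)
  \<comment> \<open>The product rule also contains f and g undifferentiated, so their order k + 1 is
    lowered to k before the induction hypothesis applies.\<close>
  have "Ck_on k S (\<lambda>x. f x * frechet_derivative g (at x) v + frechet_derivative f (at x) v * g x)" for v
    using Suc.prems Ck_on_lower[OF Suc.prems(1)] Ck_on_lower[OF Suc.prems(2)]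
    by (intro Ck_on_add[OF assms] Suc.IH) auto
  then have "Ck_on k S (\<lambda>x. frechet_derivative (\<lambda>x. f x * g x) (at x) v)" for v
    by (subst Ck_on_cong[OF \<open>open S\<close>]) (auto simp: frechet_derivative_eqI[OF der])
  then show ?case using der by (auto simp: differentiable_def)
qed

text \<open>The derivative of 1/f contains 1/f only undifferentiated, so order k + 1 follows from
  order k of 1/f and of the derivatives of f.\<close>

lemma Ck_on_inverse:
  fixes f :: "'e::real_normed_vector \<Rightarrow> 'b::real_normed_field"
  assumes "open S" "\<And>x. x \<in> S \<Longrightarrow> f x \<noteq> 0"
  shows "Ck_on k S f \<Longrightarrow> Ck_on k S (\<lambda>x. inverse (f x))"
proof (induction k)
  case 0
  then show ?case using assms by (simp add: continuous_on_inverse)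
next
  case (Suc k)
  have der: "((\<lambda>x. inverse (f x)) has_derivative
      (\<lambda>v. - (inverse (f x) * frechet_derivative f (at x) v * inverse (f x)))) (at x)" if "x \<in> S" for x
    by (intro Deriv.has_derivative_inverse assms(2)[OF that] has_derivative_frechet) (use Suc.prems that in auto)
  have I: "Ck_on k S (\<lambda>x. inverse (f x))" using Suc Ck_on_lower by blast
  have "Ck_on k S (\<lambda>x. frechet_derivative (\<lambda>x. inverse (f x)) (at x) v)" for v
    apply (subst Ck_on_cong[OF \<open>open S\<close>])
     apply (subst frechet_derivative_eqI[OF der], assumption, subst mult_minus1[symmetric], rule refl)
    using I Suc.prems by (intro Ck_on_mult[OF \<open>open S\<close>] Ck_on_const) auto
  then show ?case using der by (auto simp: differentiable_def)
qed

section \<open>Symmetry of second derivatives\<close>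

lemma has_real_derivative_along_line:
  fixes f :: "'e::real_normed_vector \<Rightarrow> real"
  assumes "f differentiable (at (w + s *\<^sub>R u))"
  shows "((\<lambda>s. f (w + s *\<^sub>R u)) has_real_derivative frechet_derivative f (at (w + s *\<^sub>R u)) u) (at s)"
proof -
  let ?D = "frechet_derivative f (at (w + s *\<^sub>R u))"
  have "((\<lambda>s. w + s *\<^sub>R u) has_derivative (\<lambda>h. h *\<^sub>R u)) (at s)"
    by (auto intro!: derivative_eq_intros)
  from has_derivative_compose[OF this has_derivative_frechet[OF assms]]
  have "((\<lambda>s. f (w + s *\<^sub>R u)) has_derivative (\<lambda>h. ?D (h *\<^sub>R u))) (at s)" .
  moreover have "?D (h *\<^sub>R u) = ?D u * h" for h
    using linear_scale[OF linear_frechet_derivative[OF assms]] by simp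
  ultimately show ?thesis by (simp add: has_field_derivative_def)
qed

text \<open>The second difference is an increment of the function s \<mapsto> f(x + hv + su) - f(x +
  su). The mean value theorem in direction u, then in direction v, contributes one factor h each
  time.\<close>

lemma second_difference_mvt:
  fixes f :: "'e::real_normed_vector \<Rightarrow> real"
  assumes f: "Ck_on 2 S f" and h: "h > 0"
    and S: "\<And>s t. 0 \<le> s \<Longrightarrow> s \<le> h \<Longrightarrow> 0 \<le> t \<Longrightarrow> t \<le> h \<Longrightarrow> x + s *\<^sub>R u + t *\<^sub>R v \<in> S"
  obtains s t where "0 \<le> s" "s \<le> h" "0 \<le> t" "t \<le> h"
    "f (x + h *\<^sub>R u + h *\<^sub>R v) - f (x + h *\<^sub>R v) - f (x + h *\<^sub>R u) + f x =
      h\<^sup>2 * frechet_derivative (\<lambda>y. frechet_derivative f (at y) u) (at (x + s *\<^sub>R u + t *\<^sub>R v)) v"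
proof -
  let ?fu = "\<lambda>y. frechet_derivative f (at y) u"
  let ?fuv = "\<lambda>y. frechet_derivative ?fu (at y) v"
  have d: "f differentiable (at y)" "?fu differentiable (at y)" if "y \<in> S" for y
    using f that by (auto simp: numeral_2_eq_2)
  let ?g = "\<lambda>s. f (x + h *\<^sub>R v + s *\<^sub>R u) - f (x + s *\<^sub>R u)"
  have "(?g has_real_derivative ?fu (x + h *\<^sub>R v + s *\<^sub>R u) - ?fu (x + s *\<^sub>R u)) (at s)" if "0 \<le> s" "s \<le> h" for s
    using S[of s h] S[of s 0] that h
    by (intro DERIV_diff has_real_derivative_along_line d) (auto simp: algebra_simps)
  from MVT2[of 0 h ?g, OF h this] obtain s where s: "0 < s" "s < h"
    "?g h - ?g 0 = h * (?fu (x + h *\<^sub>R v + s *\<^sub>R u) - ?fu (x + s *\<^sub>R u))" by auto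
  let ?k = "\<lambda>t. ?fu (x + s *\<^sub>R u + t *\<^sub>R v)"
  have "(?k has_real_derivative ?fuv (x + s *\<^sub>R u + t *\<^sub>R v)) (at t)" if "0 \<le> t" "t \<le> h" for t
    using S[of s t] that s by (intro has_real_derivative_along_line d) auto
  from MVT2[of 0 h ?k, OF h this] obtain t where t: "0 < t" "t < h"
    "?k h - ?k 0 = h * ?fuv (x + s *\<^sub>R u + t *\<^sub>R v)" by auto
  have "f (x + h *\<^sub>R u + h *\<^sub>R v) - f (x + h *\<^sub>R v) - f (x + h *\<^sub>R u) + f x = ?g h - ?g 0"
    by (simp add: algebra_simps)
  also have "\<dots> = h * (?k h - ?k 0)" using s by (simp add: algebra_simps)
  also have "\<dots> = h\<^sup>2 * ?fuv (x + s *\<^sub>R u + t *\<^sub>R v)" using t by (simp add: power2_eq_square)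
  finally show thesis using that s t by (meson less_imp_le)
qed

text \<open>The second difference is symmetric in u and v, so the two mixed derivatives agree at
  some pair of points near x; by continuity their values at x differ by at most any given e >
  0.\<close>

lemma second_derivative_symmetric:
  fixes f :: "'e::real_normed_vector \<Rightarrow> real"
  assumes f: "Ck_on 2 S f" and S: "open S" "x \<in> S"
  shows "frechet_derivative (\<lambda>y. frechet_derivative f (at y) u) (at x) v =
    frechet_derivative (\<lambda>y. frechet_derivative f (at y) v) (at x) u"
proof (rule dense_eq0_I[of "_ - _", THEN eq_iff_diff_eq_0[THEN iffD2]])
  let ?d = "\<lambda>u v y. frechet_derivative (\<lambda>y. frechet_derivative f (at y) u) (at y) v"
  fix e :: real assume "e > 0"
  then have e: "e / 2 > 0" by simp
  have ct: "isCont (?d u v) x" for u v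
  proof -
    have "continuous_on S (?d u v)" using f by (simp add: numeral_2_eq_2)
    then show ?thesis using S by (simp add: continuous_on_eq_continuous_at)
  qed
  obtain d0 where d0: "d0 > 0" "\<And>y. dist y x < d0 \<Longrightarrow> y \<in> S"
    using S by (auto simp: open_dist)
  obtain d1 where d1: "d1 > 0" "\<And>y. dist y x < d1 \<Longrightarrow> dist (?d u v y) (?d u v x) < e / 2"
    using ct[of u v] e unfolding continuous_at_eps_delta by blast
  obtain d2 where d2: "d2 > 0" "\<And>y. dist y x < d2 \<Longrightarrow> dist (?d v u y) (?d v u x) < e / 2"
    using ct[of v u] e unfolding continuous_at_eps_delta by blast
  define d where "d = min d0 (min d1 d2)"
  \<comment> \<open>Keeps the points x + su + tv with s, t between 0 and h within distance d of x;
    the summand 1 keeps the denominator positive when u = v = 0.\<close>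
  define h where "h = d / (2 * (norm u + norm v + 1))"
  have dpos: "d > 0" using d0 d1 d2 by (simp add: d_def)
  have n: "norm u + norm v + 1 > 0" by (smt (verit) norm_ge_zero)
  have h: "h > 0" using dpos n by (simp add: h_def)
  \<comment> \<open>Formulated for a, b so as to serve both (u, v) and (v, u).\<close>
  have close: "norm (s *\<^sub>R a + t *\<^sub>R b) < d"
    if "0 \<le> s" "s \<le> h" "0 \<le> t" "t \<le> h" "norm a + norm b = norm u + norm v" for s t and a b :: 'e
  proof -
    have "norm (s *\<^sub>R a + t *\<^sub>R b) \<le> s * norm a + t * norm b"
      using norm_triangle_ineq[of "s *\<^sub>R a" "t *\<^sub>R b"] that by simp
    also have "\<dots> \<le> h * norm a + h * norm b" using that by (intro add_mono mult_right_mono) auto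
    also have "\<dots> = h * (norm u + norm v)" using that by (metis distrib_left)
    also have "\<dots> < h * (2 * (norm u + norm v + 1))"
      using h by (intro mult_strict_left_mono) (smt (verit) norm_ge_zero)+
    also have "\<dots> = d" using n by (simp add: h_def)
    finally show ?thesis .
  qed
  have cl: "dist (x + s *\<^sub>R a + t *\<^sub>R b) x < d"
    if "0 \<le> s" "s \<le> h" "0 \<le> t" "t \<le> h" "norm a + norm b = norm u + norm v" for s t and a b :: 'e
    using close[OF that] by (simp add: dist_norm add.assoc)
  obtain s t where 1: "0 \<le> s" "s \<le> h" "0 \<le> t" "t \<le> h"
    "f (x + h *\<^sub>R u + h *\<^sub>R v) - f (x + h *\<^sub>R v) - f (x + h *\<^sub>R u) + f x = h\<^sup>2 * ?d u v (x + s *\<^sub>R u + t *\<^sub>R v)"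
    by (rule second_difference_mvt[OF f h, of x u v]) (use cl[of _ _ u v] d0 in \<open>auto simp: d_def\<close>)
  obtain s' t' where 2: "0 \<le> s'" "s' \<le> h" "0 \<le> t'" "t' \<le> h"
    "f (x + h *\<^sub>R v + h *\<^sub>R u) - f (x + h *\<^sub>R u) - f (x + h *\<^sub>R v) + f x = h\<^sup>2 * ?d v u (x + s' *\<^sub>R v + t' *\<^sub>R u)"
    by (rule second_difference_mvt[OF f h, of x v u]) (use cl[of _ _ v u] d0 in \<open>auto simp: d_def add.commute\<close>)
  have "h\<^sup>2 * ?d u v (x + s *\<^sub>R u + t *\<^sub>R v) = h\<^sup>2 * ?d v u (x + s' *\<^sub>R v + t' *\<^sub>R u)"
    using 1(5) 2(5) by (simp add: algebra_simps)
  then have "?d u v (x + s *\<^sub>R u + t *\<^sub>R v) = ?d v u (x + s' *\<^sub>R v + t' *\<^sub>R u)"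
    using h by simp
  moreover have "dist (?d u v (x + s *\<^sub>R u + t *\<^sub>R v)) (?d u v x) < e / 2"
    using cl[of s t u v] 1 by (intro d1) (auto simp: d_def)
  moreover have "dist (?d v u (x + s' *\<^sub>R v + t' *\<^sub>R u)) (?d v u x) < e / 2"
    using cl[of s' t' v u] 2 by (intro d2) (auto simp: d_def)
  ultimately show "\<bar>?d u v x - ?d v u x\<bar> \<le> e" unfolding dist_real_def by (smt (verit) field_sum_of_halves)
qed

section \<open>Calculus in a chart\<close>

text \<open>The part of \<open>smooth_atlas\<close> that concerns a single chart.\<close>

definition good_chart :: "('a::topological_space, 'm::finite) chart \<Rightarrow> bool" where
  "good_chart c \<longleftrightarrow> open (fst c) \<and> open (snd c ` fst c) \<and>
     homeomorphism (fst c) (snd c ` fst c) (snd c) (chart_inv c)"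

definition chart_differentiable ::
    "('a, 'm::finite) chart \<Rightarrow> ('a \<Rightarrow> 'b::real_normed_vector) \<Rightarrow> 'a \<Rightarrow> bool" where
  "chart_differentiable c f p \<longleftrightarrow> (f \<circ> chart_inv c) differentiable (at (snd c p))"

lemma chart_inv_left: "good_chart c \<Longrightarrow> p \<in> fst c \<Longrightarrow> chart_inv c (snd c p) = p"
  by (simp add: good_chart_def homeomorphism_def)

lemma chart_image_open:
  assumes "good_chart c" "open U"
  shows "open (snd c ` (U \<inter> fst c))"
proof -
  have h: "homeomorphism (fst c) (snd c ` fst c) (snd c) (chart_inv c)"
    and o: "open (snd c ` fst c)" "open (fst c)"
    using assms by (auto simp: good_chart_def)
  have "openin (top_of_set (fst c)) (U \<inter> fst c)"
    using assms o by (metis inf_commute openin_open_Int)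
  from homeomorphism_imp_open_map[OF h this] show ?thesis
    using o by (metis openin_open_eq)
qed

lemma chart_transform:
  assumes "good_chart c" "open N" "p \<in> N" "p \<in> fst c" "\<And>q. q \<in> N \<Longrightarrow> q \<in> fst c \<Longrightarrow> f q = g q"
    and d: "((f \<circ> chart_inv c) has_derivative f') (at (snd c p))"
  shows "((g \<circ> chart_inv c) has_derivative f') (at (snd c p))"
proof (rule has_derivative_transform_within_open[OF d chart_image_open[OF assms(1,2)]])
  show "snd c p \<in> snd c ` (N \<inter> fst c)" using assms(3,4) by blast
  fix x assume "x \<in> snd c ` (N \<inter> fst c)"
  then obtain q where "x = snd c q" "q \<in> N" "q \<in> fst c" by blast
  then show "(f \<circ> chart_inv c) x = (g \<circ> chart_inv c) x"
    using assms(5) by (simp add: chart_inv_left[OF assms(1)])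
qed

lemma chart_pd_cong:
  assumes "good_chart c" "open N" "p \<in> N" "p \<in> fst c" "\<And>q. q \<in> N \<Longrightarrow> q \<in> fst c \<Longrightarrow> f q = g q"
    and d: "chart_differentiable c f p"
  shows "chart_pd c i f p = chart_pd c i g p"
  unfolding chart_pd_def
  by (subst frechet_derivative_eqI[OF chart_transform[OF assms(1-5) has_derivative_frechet]])
     (use d in \<open>auto simp: chart_differentiable_def\<close>)

lemma chart_differentiable_D:
  "chart_differentiable c f p \<Longrightarrow>
    ((f \<circ> chart_inv c) has_derivative frechet_derivative (f \<circ> chart_inv c) (at (snd c p))) (at (snd c p))"
  by (simp add: chart_differentiable_def has_derivative_frechet)

lemma chart_differentiableI:
  assumes "((f \<circ> chart_inv c) has_derivative f') (at (snd c p))"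
  shows "chart_differentiable c f p" "chart_pd c i f p = f' (axis i 1)"
  using assms frechet_derivative_eqI[OF assms] by (auto simp: chart_differentiable_def differentiable_def chart_pd_def)

lemma chart_const: "chart_differentiable c (\<lambda>q. k) p" "chart_pd c i (\<lambda>q. k) p = 0"
  using chart_differentiableI[of "\<lambda>q. k" c "\<lambda>v. 0" p] by (auto simp: o_def)

lemma chart_add:
  assumes "chart_differentiable c f p" "chart_differentiable c g p"
  shows "chart_differentiable c (\<lambda>q. f q + g q) p"
    "chart_pd c i (\<lambda>q. f q + g q) p = chart_pd c i f p + chart_pd c i g p"
  using chart_differentiableI[of "\<lambda>q. f q + g q" c _ p]
    has_derivative_add[OF assms[THEN chart_differentiable_D]]
  by (auto simp: o_def chart_pd_def)

lemma chart_mult: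
  fixes f g :: "'a::topological_space \<Rightarrow> 'b::real_normed_algebra"
  assumes "good_chart c" "p \<in> fst c" "chart_differentiable c f p" "chart_differentiable c g p"
  shows "chart_differentiable c (\<lambda>q. f q * g q) p"
    "chart_pd c i (\<lambda>q. f q * g q) p = f p * chart_pd c i g p + chart_pd c i f p * g p"
  using chart_differentiableI[of "\<lambda>q. f q * g q" c _ p] chart_inv_left[OF assms(1,2)]
    has_derivative_mult[OF assms(3,4)[THEN chart_differentiable_D]]
  by (auto simp: o_def chart_pd_def)

lemma chart_linear:
  assumes "bounded_linear L" "chart_differentiable c f p"
  shows "chart_differentiable c (\<lambda>q. L (f q)) p" "chart_pd c i (\<lambda>q. L (f q)) p = L (chart_pd c i f p)"
  using chart_differentiableI[of "\<lambda>q. L (f q)" c _ p]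
    bounded_linear.has_derivative[OF assms(1) assms(2)[THEN chart_differentiable_D]]
  by (auto simp: o_def chart_pd_def)

lemma chart_sum:
  assumes "finite I" "\<And>k. k \<in> I \<Longrightarrow> chart_differentiable c (f k) p"
  shows "chart_differentiable c (\<lambda>q. \<Sum>k\<in>I. f k q) p \<and>
    chart_pd c i (\<lambda>q. \<Sum>k\<in>I. f k q) p = (\<Sum>k\<in>I. chart_pd c i (f k) p)"
  using assms by (induction I rule: finite_induct) (auto simp: chart_const chart_add)

section \<open>Smooth functions read in a chart\<close>

lemma chart_smooth_imp_Ck:
  "chart_smooth_on c U f \<Longrightarrow> Ck_on k (snd c ` (U \<inter> fst c)) (f \<circ> chart_inv c)"
  by (simp add: chart_smooth_on_def smooth_on_def)

lemma chart_smoothI: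
  "(\<And>k. Ck_on k (snd c ` (U \<inter> fst c)) (f \<circ> chart_inv c)) \<Longrightarrow> chart_smooth_on c U f"
  by (simp add: chart_smooth_on_def smooth_on_def)

lemma chart_smooth_differentiable:
  assumes "chart_smooth_on c U f" "p \<in> U" "p \<in> fst c"
  shows "chart_differentiable c f p"
  using chart_smooth_imp_Ck[OF assms(1), of "Suc 0"] assms(2,3) by (auto simp: chart_differentiable_def)

lemma chart_smooth_cong:
  assumes "good_chart c" "open U" "\<And>q. q \<in> U \<Longrightarrow> q \<in> fst c \<Longrightarrow> f q = g q" "chart_smooth_on c U f"
  shows "chart_smooth_on c U g"
proof (rule chart_smoothI)
  fix k
  have "(f \<circ> chart_inv c) x = (g \<circ> chart_inv c) x" if "x \<in> snd c ` (U \<inter> fst c)" for x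
    using that assms(3) by (auto simp: chart_inv_left[OF assms(1)])
  then show "Ck_on k (snd c ` (U \<inter> fst c)) (g \<circ> chart_inv c)"
    using Ck_on_cong[OF chart_image_open[OF assms(1,2)], of "f \<circ> chart_inv c" "g \<circ> chart_inv c" k]
      chart_smooth_imp_Ck[OF assms(4), of k] by blast
qed

lemma chart_smooth_subset: "chart_smooth_on c U f \<Longrightarrow> V \<subseteq> U \<Longrightarrow> chart_smooth_on c V f"
  by (intro chart_smoothI) (rule Ck_on_subset[OF chart_smooth_imp_Ck], assumption, blast)

text \<open>Meant for fields that are known near each point only through a local contact
  form.\<close>

lemma chart_smooth_local:
  assumes "good_chart c"
    and "\<And>p. p \<in> U \<Longrightarrow> p \<in> fst c \<Longrightarrow> \<exists>V. open V \<and> p \<in> V \<and> chart_smooth_on c V f"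
  shows "chart_smooth_on c U f"
proof (rule chart_smoothI, rule Ck_on_local)
  fix k x assume "x \<in> snd c ` (U \<inter> fst c)"
  then obtain p where p: "x = snd c p" "p \<in> U" "p \<in> fst c" by auto
  then obtain V where "open V" "p \<in> V" "chart_smooth_on c V f" using assms(2) by blast
  then show "\<exists>T. open T \<and> x \<in> T \<and> Ck_on k T (f \<circ> chart_inv c)"
    using p by (intro exI[of _ "snd c ` (V \<inter> fst c)"] conjI chart_image_open[OF assms(1)] chart_smooth_imp_Ck) auto
qed

lemma chart_smooth_const: "chart_smooth_on c U (\<lambda>q. k)"
  by (intro chart_smoothI) (simp add: o_def Ck_on_const)

lemma chart_smooth_linear:
  assumes "good_chart c" "open U" "bounded_linear L" "chart_smooth_on c U f"
  shows "chart_smooth_on c U (\<lambda>q. L (f q))"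
  using Ck_on_linear[OF assms(3) chart_image_open[OF assms(1,2)] chart_smooth_imp_Ck[OF assms(4)]]
  by (intro chart_smoothI) (simp add: o_def)

lemma chart_smooth_add:
  assumes "good_chart c" "open U" "chart_smooth_on c U f" "chart_smooth_on c U g"
  shows "chart_smooth_on c U (\<lambda>q. f q + g q)"
  using Ck_on_add[OF chart_image_open[OF assms(1,2)] assms(3,4)[THEN chart_smooth_imp_Ck]]
  by (intro chart_smoothI) (simp add: o_def)

lemma chart_smooth_mult:
  fixes f g :: "'a::topological_space \<Rightarrow> 'b::real_normed_algebra"
  assumes "good_chart c" "open U" "chart_smooth_on c U f" "chart_smooth_on c U g"
  shows "chart_smooth_on c U (\<lambda>q. f q * g q)"
  using Ck_on_mult[OF chart_image_open[OF assms(1,2)] assms(3,4)[THEN chart_smooth_imp_Ck]]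
  by (intro chart_smoothI) (simp add: o_def)

lemma chart_smooth_uminus:
  assumes "good_chart c" "open U" "chart_smooth_on c U f"
  shows "chart_smooth_on c U (\<lambda>q. - f q)"
  using chart_smooth_linear[OF assms(1,2) bounded_linear_minus[OF bounded_linear_ident] assms(3)] .

lemma chart_smooth_diff:
  assumes "good_chart c" "open U" "chart_smooth_on c U f" "chart_smooth_on c U g"
  shows "chart_smooth_on c U (\<lambda>q. f q - g q)"
  using chart_smooth_add[OF assms(1-3) chart_smooth_uminus[OF assms(1,2,4)]] by simp

lemma chart_smooth_inverse:
  fixes f :: "'a::topological_space \<Rightarrow> 'b::real_normed_field"
  assumes "good_chart c" "open U" "\<And>q. q \<in> U \<Longrightarrow> q \<in> fst c \<Longrightarrow> f q \<noteq> 0" "chart_smooth_on c U f"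
  shows "chart_smooth_on c U (\<lambda>q. inverse (f q))"
proof (rule chart_smoothI)
  fix k
  have "(f \<circ> chart_inv c) x \<noteq> 0" if "x \<in> snd c ` (U \<inter> fst c)" for x
    using that assms(3) by (auto simp: chart_inv_left[OF assms(1)])
  from Ck_on_inverse[OF chart_image_open[OF assms(1,2)] this chart_smooth_imp_Ck[OF assms(4)]]
  show "Ck_on k (snd c ` (U \<inter> fst c)) ((\<lambda>q. inverse (f q)) \<circ> chart_inv c)" by (simp add: o_def)
qed

lemma chart_smooth_sum:
  assumes "good_chart c" "open U" "finite I" "\<And>k. k \<in> I \<Longrightarrow> chart_smooth_on c U (f k)"
  shows "chart_smooth_on c U (\<lambda>q. \<Sum>k\<in>I. f k q)"
  using assms(3,4)
  by (induction I rule: finite_induct) (auto simp: chart_smooth_const intro: chart_smooth_add[OF assms(1,2)])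

lemma chart_smooth_prod:
  fixes f :: "'k \<Rightarrow> 'a::topological_space \<Rightarrow> 'b::real_normed_field"
  assumes "good_chart c" "open U" "finite I" "\<And>k. k \<in> I \<Longrightarrow> chart_smooth_on c U (f k)"
  shows "chart_smooth_on c U (\<lambda>q. \<Prod>k\<in>I. f k q)"
  using assms(3,4)
  by (induction I rule: finite_induct) (auto simp: chart_smooth_const intro: chart_smooth_mult[OF assms(1,2)])

text \<open>The Leibniz formula makes the determinant a polynomial in the entries; this turns
  Cramer's rule into a source of smooth solutions.\<close>

lemma chart_smooth_det:
  fixes M :: "'a::topological_space \<Rightarrow> 'b::real_normed_field^'k::finite^'k"
  assumes "good_chart c" "open U" "\<And>i j. chart_smooth_on c U (\<lambda>q. M q $ i $ j)"
  shows "chart_smooth_on c U (\<lambda>q. det (M q))"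
  unfolding det_def
  by (intro chart_smooth_sum chart_smooth_mult chart_smooth_prod assms chart_smooth_const) auto

lemma bounded_linear_axis: "bounded_linear (axis i :: 'b::real_normed_vector \<Rightarrow> 'b^'k::finite)"
proof (rule bounded_linear_intro[where K = 1])
  fix x y :: 'b and r
  show "axis i (x + y) = (axis i x + axis i y :: 'b^'k)" by (auto simp: axis_def vec_eq_iff)
  show "axis i (r *\<^sub>R x) = (r *\<^sub>R axis i x :: 'b^'k)" by (auto simp: axis_def vec_eq_iff)
  show "norm (axis i x :: 'b^'k) \<le> norm x * 1"
    by (simp add: norm_vec_def L2_set_def axis_def if_distrib[of norm] if_distrib[of "\<lambda>x. x\<^sup>2"] cong: if_cong)
qed

lemma chart_smooth_vec:
  fixes f :: "'a::topological_space \<Rightarrow> 'b::real_normed_vector^'k::finite"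
  assumes "good_chart c" "open U" "\<And>i. chart_smooth_on c U (\<lambda>q. f q $ i)"
  shows "chart_smooth_on c U f"
proof -
  have "chart_smooth_on c U (\<lambda>q. \<Sum>i\<in>UNIV. axis i (f q $ i))"
    by (intro chart_smooth_sum chart_smooth_linear[OF _ _ bounded_linear_axis] assms) auto
  moreover have "(\<Sum>i\<in>UNIV. axis i (x $ i)) = x" for x :: "'b^'k"
    by (simp add: vec_eq_iff axis_def if_distrib if_distribR cong: if_cong)
  ultimately show ?thesis by simp
qed

lemma chart_smooth_nth:
  assumes "good_chart c" "open U" "chart_smooth_on c U f"
  shows "chart_smooth_on c U (\<lambda>q. f q $ i)"
  by (rule chart_smooth_linear[OF assms(1,2) bounded_linear_vec_nth assms(3)])

lemma chart_pd_chart_inv: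
  assumes "good_chart c" "x \<in> snd c ` (U \<inter> fst c)"
  shows "(chart_pd c i f \<circ> chart_inv c) x = frechet_derivative (f \<circ> chart_inv c) (at x) (axis i 1)"
  using assms(2) by (auto simp: chart_pd_def chart_inv_left[OF assms(1)])

lemma chart_smooth_pd:
  assumes "good_chart c" "open U" "chart_smooth_on c U f"
  shows "chart_smooth_on c U (chart_pd c i f)"
proof (rule chart_smoothI)
  fix k
  show "Ck_on k (snd c ` (U \<inter> fst c)) (chart_pd c i f \<circ> chart_inv c)"
    using chart_smooth_imp_Ck[OF assms(3), of "Suc k"]
      Ck_on_cong[OF chart_image_open[OF assms(1,2)], of "chart_pd c i f \<circ> chart_inv c" "\<lambda>x. frechet_derivative (f \<circ> chart_inv c) (at x) (axis i 1)" k]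
      chart_pd_chart_inv[OF assms(1)] unfolding Ck_on.simps by blast
qed

lemma chart_pd_commute:
  fixes f :: "'a::topological_space \<Rightarrow> real"
  assumes "good_chart c" "open U" "chart_smooth_on c U f" "p \<in> U" "p \<in> fst c"
  shows "chart_pd c i (chart_pd c j f) p = chart_pd c j (chart_pd c i f) p"
proof -
  let ?W = "snd c ` (U \<inter> fst c)"
  let ?g = "f \<circ> chart_inv c"
  have W: "open ?W" "snd c p \<in> ?W" using chart_image_open[OF assms(1,2)] assms(4,5) by blast+
  have "chart_pd c i (chart_pd c j f) p =
    frechet_derivative (\<lambda>y. frechet_derivative ?g (at y) (axis j 1)) (at (snd c p)) (axis i 1)" for i j
  proof -
    have "((chart_pd c j f \<circ> chart_inv c) has_derivative frechet_derivative (chart_pd c j f \<circ> chart_inv c) (at (snd c p))) (at (snd c p))"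
      using chart_smooth_differentiable[OF chart_smooth_pd[OF assms(1-3)] assms(4,5)]
      by (rule chart_differentiable_D)
    \<comment> \<open>\<open>chart_pd c j f \<circ> chart_inv c\<close> is the directional
      derivative of \<open>?g\<close> only on the open image \<open>?W\<close>; this suffices for
      differentiating it once more at \<open>snd c p\<close>.\<close>
    from has_derivative_transform_within_open[OF this W, of "\<lambda>y. frechet_derivative ?g (at y) (axis j 1)"]
    have "((\<lambda>y. frechet_derivative ?g (at y) (axis j 1)) has_derivative
        frechet_derivative (chart_pd c j f \<circ> chart_inv c) (at (snd c p))) (at (snd c p))"
      using chart_pd_chart_inv[OF assms(1)] by blast
    from frechet_derivative_eqI[OF this] show ?thesis unfolding chart_pd_def[of c i] by simp
  qed
  then show ?thesis
    using second_derivative_symmetric[OF chart_smooth_imp_Ck[OF assms(3)] W] by simp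
qed

text \<open>Near p, f read in c is f read in d composed with the transition map. The equality holds
  only over the overlap of the domains, so it is used through
  \<open>chart_transform\<close>.\<close>

lemma chart_pd_chain:
  fixes f :: "'a::topological_space \<Rightarrow> 'b::real_normed_vector"
  assumes c: "good_chart c" and d: "good_chart d" and p: "p \<in> fst c" "p \<in> fst d"
    and tr: "chart_smooth_on c (fst d) (snd d)" and f: "chart_differentiable d f p"
  shows "chart_differentiable c f p"
    "chart_pd c i f p = (\<Sum>k\<in>UNIV. (chart_pd c i (snd d) p $ k) *\<^sub>R chart_pd d k f p)"
proof -
  let ?T = "frechet_derivative (snd d \<circ> chart_inv c) (at (snd c p))"
  let ?D = "frechet_derivative (f \<circ> chart_inv d) (at (snd d p))"
  have T: "((snd d \<circ> chart_inv c) has_derivative ?T) (at (snd c p))"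
    using chart_smooth_differentiable[OF tr p(2,1)] by (rule chart_differentiable_D)
  have D: "((f \<circ> chart_inv d) has_derivative ?D) (at ((snd d \<circ> chart_inv c) (snd c p)))"
    using chart_differentiable_D[OF f] chart_inv_left[OF c p(1)] by simp
  have "((f \<circ> chart_inv d \<circ> (snd d \<circ> chart_inv c)) has_derivative ?D \<circ> ?T) (at (snd c p))"
    using diff_chain_at[OF T D] .
  then have "(((\<lambda>q. f (chart_inv d (snd d q))) \<circ> chart_inv c) has_derivative ?D \<circ> ?T) (at (snd c p))"
    by (simp add: o_def)
  then have main: "((f \<circ> chart_inv c) has_derivative ?D \<circ> ?T) (at (snd c p))"
    by (rule chart_transform[OF c _ p(2,1), rotated 2]) (use d in \<open>auto simp: chart_inv_left[OF d]\<close>, simp add: good_chart_def)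
  show "chart_differentiable c f p" using chart_differentiableI(1)[OF main] .
  have "chart_pd c i f p = ?D (chart_pd c i (snd d) p)"
    using chart_differentiableI(2)[OF main] by (simp add: chart_pd_def)
  also have "\<dots> = ?D (\<Sum>k\<in>UNIV. (chart_pd c i (snd d) p $ k) *\<^sub>R axis k 1)"
    using basis_expansion[of "chart_pd c i (snd d) p"] by (simp add: scalar_mult_eq_scaleR)
  also have "\<dots> = (\<Sum>k\<in>UNIV. (chart_pd c i (snd d) p $ k) *\<^sub>R chart_pd d k f p)"
    using f by (simp add: linear_sum[OF linear_frechet_derivative] linear_scale[OF linear_frechet_derivative]
      chart_differentiable_def chart_pd_def)
  finally show "chart_pd c i f p = (\<Sum>k\<in>UNIV. (chart_pd c i (snd d) p $ k) *\<^sub>R chart_pd d k f p)" .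
qed

section \<open>The linear system for contact vector fields\<close>

text \<open>The components of the exterior derivative of a 1-form with component functions
  \<open>a\<close>. They are complex, unlike \<open>ext_deriv\<close>, to be multiplied with
  components of vector fields directly.\<close>

definition form_curl ::
    "('a, 'm::finite) chart \<Rightarrow> ('m \<Rightarrow> 'a \<Rightarrow> complex) \<Rightarrow> 'm \<Rightarrow> 'm \<Rightarrow> 'a \<Rightarrow> complex" where
  "form_curl c a i j p = chart_pd c i (a j) p - chart_pd c j (a i) p"

text \<open>Substituting \<open>L\<^sub>B \<alpha> = i\<^sub>B d\<alpha> + d(\<alpha>(B))\<close> turns the condition \<open>L\<^sub>B \<alpha> = g \<alpha>\<close> with prescribed
  Hamiltonian \<open>\<alpha>(B) = h\<close> into this linear system for the value \<open>b\<close> of \<open>B\<close> at \<open>p\<close> and for \<open>g\<close>.\<close>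

definition contact_system ::
    "('a, 'm::finite) chart \<Rightarrow> ('m \<Rightarrow> 'a \<Rightarrow> complex) \<Rightarrow> ('a \<Rightarrow> complex) \<Rightarrow> complex^'m \<Rightarrow> complex \<Rightarrow> 'a \<Rightarrow> bool"
  where
  "contact_system c a h b g p \<longleftrightarrow> (\<Sum>i\<in>UNIV. a i p * b $ i) = h p \<and>
     (\<forall>j. (\<Sum>i\<in>UNIV. b $ i * form_curl c a i j p) + chart_pd c j h p = g * a j p)"

text \<open>This is d(f\<alpha>) = f d\<alpha> + df \<and> \<alpha> in components.\<close>

lemma form_curl_scale:
  assumes c: "good_chart c" and N: "open N" "p \<in> N" "p \<in> fst c"
    and eq: "\<And>j q. q \<in> N \<Longrightarrow> q \<in> fst c \<Longrightarrow> a' j q = f q * a j q"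
    and f: "chart_differentiable c f p" and a: "\<And>j. chart_differentiable c (a j) p"
  shows "form_curl c a' i j p =
    f p * form_curl c a i j p + chart_pd c i f p * a j p - chart_pd c j f p * a i p"
proof -
  have "chart_pd c i (a' j) p = f p * chart_pd c i (a j) p + chart_pd c i f p * a j p" for i j
    using chart_pd_cong[OF c N, of "\<lambda>q. f q * a j q" "a' j" i] eq chart_mult[OF c N(3) f a] by simp
  then show ?thesis by (simp add: form_curl_def algebra_simps)
qed

text \<open>L_B(f\<alpha>) = f L_B \<alpha> + B(f) \<alpha>, so the same b solves the system of
  f\<alpha>; the sum in the new factor is B(f).\<close>

lemma contact_system_scale:
  assumes c: "good_chart c" and N: "open N" "p \<in> N" "p \<in> fst c"
    and eq: "\<And>j q. q \<in> N \<Longrightarrow> q \<in> fst c \<Longrightarrow> a' j q = f q * a j q"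
    and eqh: "\<And>q. q \<in> N \<Longrightarrow> q \<in> fst c \<Longrightarrow> h' q = f q * h q"
    and f: "chart_differentiable c f p" and a: "\<And>j. chart_differentiable c (a j) p"
    and h: "chart_differentiable c h p" and nz: "f p \<noteq> 0"
    and sys: "contact_system c a h b g p"
  shows "contact_system c a' h' b (g + (\<Sum>i\<in>UNIV. b $ i * chart_pd c i f p) / f p) p"
  unfolding contact_system_def
proof (intro conjI allI)
  have s1: "(\<Sum>i\<in>UNIV. a i p * b $ i) = h p"
    and s2: "\<And>j. (\<Sum>i\<in>UNIV. b $ i * form_curl c a i j p) + chart_pd c j h p = g * a j p"
    using sys by (auto simp: contact_system_def)
  have "(\<Sum>i\<in>UNIV. a' i p * b $ i) = f p * (\<Sum>i\<in>UNIV. a i p * b $ i)"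
    using eq N by (simp add: sum_distrib_left mult.assoc)
  then show "(\<Sum>i\<in>UNIV. a' i p * b $ i) = h' p" using s1 eqh N by simp
  fix j
  let ?F = "\<Sum>i\<in>UNIV. b $ i * chart_pd c i f p"
  have h': "chart_pd c j h' p = f p * chart_pd c j h p + chart_pd c j f p * h p"
    using chart_pd_cong[OF c N, of "\<lambda>q. f q * h q" h' j] eqh chart_mult[OF c N(3) f h] by simp
  have "(\<Sum>i\<in>UNIV. b $ i * form_curl c a' i j p) =
      (\<Sum>i\<in>UNIV. f p * (b $ i * form_curl c a i j p) + (b $ i * chart_pd c i f p) * a j p
         - chart_pd c j f p * (a i p * b $ i))"
    by (intro sum.cong refl) (simp add: form_curl_scale[OF c N eq f a] algebra_simps)
  also have "\<dots> = f p * (\<Sum>i\<in>UNIV. b $ i * form_curl c a i j p) + ?F * a j p - chart_pd c j f p * h p"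
    unfolding s1[symmetric] by (simp add: sum.distrib sum_subtractf sum_distrib_left sum_distrib_right)
  finally have "(\<Sum>i\<in>UNIV. b $ i * form_curl c a' i j p) + chart_pd c j h' p =
      f p * ((\<Sum>i\<in>UNIV. b $ i * form_curl c a i j p) + chart_pd c j h p) + ?F * a j p"
    using h' by (simp add: algebra_simps)
  also have "\<dots> = (g + ?F / f p) * (f p * a j p)"
    unfolding s2 using nz by (simp add: field_simps)
  finally show "(\<Sum>i\<in>UNIV. b $ i * form_curl c a' i j p) + chart_pd c j h' p = (g + ?F / f p) * a' j p"
    using eq N by simp
qed

section \<open>Behaviour under a change of charts\<close>

text \<open>The derivative of the k-th coordinate of d with respect to the i-th coordinate of c.
  Summation over i pushes vectors from c to d, summation over k pulls covectors back from d to
  c.\<close>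

definition cjac :: "('a, 'm::finite) chart \<Rightarrow> ('a, 'm) chart \<Rightarrow> 'm \<Rightarrow> 'm \<Rightarrow> 'a \<Rightarrow> complex" where
  "cjac c d k i q = of_real (jacobian c d q $ k $ i)"

lemma jacobian_nth: "jacobian c d q $ k $ i = chart_pd c i (snd d) q $ k"
  by (simp add: jacobian_def matrix_def chart_pd_def)

definition smooth_charts :: "('a::topological_space, 'm::finite) chart \<Rightarrow> ('a, 'm) chart \<Rightarrow> bool" where
  "smooth_charts c d \<longleftrightarrow> good_chart c \<and> good_chart d \<and>
     chart_smooth_on c (fst d) (snd d) \<and> chart_smooth_on d (fst c) (snd c)"

lemma smooth_chartsD:
  assumes "smooth_charts c d"
  shows "good_chart c" "good_chart d" "chart_smooth_on c (fst d) (snd d)" "open (fst c)" "open (fst d)"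
    "smooth_charts d c"
  using assms by (auto simp: smooth_charts_def good_chart_def)

text \<open>The first form reduces second derivatives to those of a real function, for which
  symmetry is available; the second one matches the chain rule for complex functions.\<close>

lemma cjac_pd:
  assumes "smooth_charts c d" "q \<in> fst c" "q \<in> fst d"
  shows "cjac c d k i q = of_real (chart_pd c i (\<lambda>q. snd d q $ k) q)"
    "cjac c d k i q = chart_pd c i (\<lambda>q. of_real (snd d q $ k)) q"
proof -
  have d: "chart_differentiable c (snd d) q"
    by (rule chart_smooth_differentiable[OF smooth_chartsD(3)[OF assms(1)] assms(3,2)])
  show 1: "cjac c d k i q = of_real (chart_pd c i (\<lambda>q. snd d q $ k) q)"
    unfolding cjac_def jacobian_nth chart_linear(2)[OF bounded_linear_vec_nth d] ..
  show "cjac c d k i q = chart_pd c i (\<lambda>q. of_real (snd d q $ k)) q"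
    unfolding 1 chart_linear(2)[OF bounded_linear_of_real chart_linear(1)[OF bounded_linear_vec_nth d]] ..
qed

lemma cjac_smooth:
  assumes "smooth_charts c d"
  shows "chart_smooth_on c (fst d) (cjac c d k i)"
  unfolding cjac_def jacobian_nth
  by (rule chart_smooth_linear[OF smooth_chartsD(1,5)[OF assms] bounded_linear_of_real])
     (rule chart_smooth_nth[OF smooth_chartsD(1,5)[OF assms]], rule chart_smooth_pd, (rule smooth_chartsD[OF assms])+)

lemma cjac_differentiable:
  assumes "smooth_charts c d" "p \<in> fst c" "p \<in> fst d"
  shows "chart_differentiable c (cjac c d k i) p"
  by (rule chart_smooth_differentiable[OF cjac_smooth[OF assms(1)] assms(3,2)])

text \<open>For fixed k the entries are the partial derivatives of a single function, the k-th
  coordinate of d, so this is the symmetry of its second derivatives.\<close>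

lemma chart_pd_cjac_commute:
  assumes cd: "smooth_charts c d" and p: "p \<in> fst c" "p \<in> fst d"
  shows "chart_pd c i (cjac c d k j) p = chart_pd c j (cjac c d k i) p"
proof -
  note g = smooth_chartsD[OF cd]
  let ?x = "\<lambda>q. snd d q $ k"
  have x: "chart_smooth_on c (fst d) ?x" by (rule chart_smooth_nth[OF g(1,5,3)])
  have "chart_pd c i (cjac c d k j) p = of_real (chart_pd c i (chart_pd c j ?x) p)" for i j
  proof -
    have "chart_pd c i (cjac c d k j) p = chart_pd c i (\<lambda>q. of_real (chart_pd c j ?x q)) p"
      by (rule chart_pd_cong[OF g(1,5) p(2,1) _ cjac_differentiable[OF cd p]]) (rule cjac_pd(1)[OF cd])
    also have "\<dots> = of_real (chart_pd c i (chart_pd c j ?x) p)"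
      by (rule chart_linear(2)[OF bounded_linear_of_real
            chart_smooth_differentiable[OF chart_smooth_pd[OF g(1,5) x] p(2,1)]])
    finally show ?thesis .
  qed
  then show ?thesis using chart_pd_commute[OF g(1,5) x p(2,1)] by simp
qed

lemma cjac_chain:
  fixes f :: "'a::topological_space \<Rightarrow> complex"
  assumes "smooth_charts c d" "p \<in> fst c" "p \<in> fst d" "chart_differentiable d f p"
  shows "chart_differentiable c f p"
    "chart_pd c i f p = (\<Sum>k\<in>UNIV. cjac c d k i p * chart_pd d k f p)"
  using chart_pd_chain[OF smooth_chartsD(1,2)[OF assms(1)] assms(2,3) smooth_chartsD(3)[OF assms(1)] assms(4)]
  by (simp_all add: cjac_def jacobian_nth scaleR_conv_of_real)

text \<open>The chain rule, applied to the k-th coordinate function of d, whose derivatives in d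
  itself are 0 or 1.\<close>

lemma cjac_inverse:
  assumes cd: "smooth_charts c d" and p: "p \<in> fst c" "p \<in> fst d"
  shows "(\<Sum>i\<in>UNIV. cjac c d k i p * cjac d c i l p) = (if k = l then 1 else 0)"
proof -
  note g = smooth_chartsD[OF cd]
  let ?f = "\<lambda>q. complex_of_real (snd d q $ k)"
  have "((\<lambda>y::real^'b. complex_of_real (y $ k)) has_derivative (\<lambda>y. of_real (y $ k))) (at (snd d p))"
    by (intro bounded_linear_imp_has_derivative bounded_linear_compose[OF bounded_linear_of_real] bounded_linear_vec_nth)
  then have "((?f \<circ> chart_inv d) has_derivative (\<lambda>y. of_real (y $ k))) (at (snd d p))"
  proof (rule has_derivative_transform_within_open)
    show "open (snd d ` fst d)" using g(2) by (simp add: good_chart_def)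
  qed (use p chart_inv_left[OF g(2)] in auto)
  from chart_differentiableI[OF this] have f: "chart_differentiable d ?f p"
    "chart_pd d l ?f p = (if k = l then 1 else 0)" by (auto simp: axis_def)
  have fc: "chart_differentiable c ?f p" by (rule cjac_chain(1)[OF cd p f(1)])
  show ?thesis
    using cjac_chain(2)[OF g(6) p(2,1) fc, of l] f(2) cjac_pd(2)[OF cd p, of k]
    by (simp add: mult.commute)
qed

text \<open>The exterior derivative commutes with pullback: differentiating the Jacobian gives terms
  symmetric in i and j, which antisymmetrization removes.\<close>

lemma form_curl_pullback:
  assumes cd: "smooth_charts c d" and N: "open N" "p \<in> N" and p: "p \<in> fst c" "p \<in> fst d"
    and eq: "\<And>j q. q \<in> N \<Longrightarrow> q \<in> fst c \<Longrightarrow> q \<in> fst d \<Longrightarrow> a' j q = (\<Sum>k\<in>UNIV. cjac c d k j q * a k q)"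
    and a: "\<And>j. chart_differentiable d (a j) p"
  shows "form_curl c a' i j p = (\<Sum>l\<in>UNIV. \<Sum>k\<in>UNIV. cjac c d l i p * cjac c d k j p * form_curl d a l k p)"
proof -
  note g = smooth_chartsD[OF cd]
  let ?J = "\<lambda>k i. cjac c d k i p"
  have N': "open (N \<inter> fst d)" "p \<in> N \<inter> fst d" using N g p by auto
  have m: "chart_differentiable c (\<lambda>q. cjac c d k j q * a k q) p" for k j
    by (rule chart_mult(1)[OF g(1) p(1) cjac_differentiable[OF cd p] cjac_chain(1)[OF cd p a]])
  have pd: "chart_pd c i (a' j) p =
    (\<Sum>k\<in>UNIV. \<Sum>l\<in>UNIV. ?J l i * ?J k j * chart_pd d l (a k) p) +
    (\<Sum>k\<in>UNIV. chart_pd c i (cjac c d k j) p * a k p)" for i j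
  proof -
    have "chart_pd c i (a' j) p = chart_pd c i (\<lambda>q. \<Sum>k\<in>UNIV. cjac c d k j q * a k q) p"
      by (rule chart_pd_cong[OF g(1) N' p(1), symmetric])
         (use eq in \<open>auto intro!: chart_sum[THEN conjunct1] m\<close>)
    also have "\<dots> = (\<Sum>k\<in>UNIV. chart_pd c i (\<lambda>q. cjac c d k j q * a k q) p)"
      by (intro chart_sum[THEN conjunct2] finite m)
    also have "\<dots> = (\<Sum>k\<in>UNIV. (\<Sum>l\<in>UNIV. ?J l i * ?J k j * chart_pd d l (a k) p) +
        chart_pd c i (cjac c d k j) p * a k p)"
      unfolding chart_mult(2)[OF g(1) p(1) cjac_differentiable[OF cd p] cjac_chain(1)[OF cd p a]]
        cjac_chain(2)[OF cd p a]
      by (simp add: sum_distrib_left mult_ac)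
    finally show ?thesis by (simp add: sum.distrib)
  qed
  have 1: "(\<Sum>k\<in>UNIV. \<Sum>l\<in>UNIV. ?J l i * ?J k j * chart_pd d l (a k) p) =
    (\<Sum>l\<in>UNIV. \<Sum>k\<in>UNIV. ?J l i * ?J k j * chart_pd d l (a k) p)"
    by (rule sum.swap)
  have 2: "(\<Sum>k\<in>UNIV. \<Sum>l\<in>UNIV. ?J l j * ?J k i * chart_pd d l (a k) p) =
    (\<Sum>l\<in>UNIV. \<Sum>k\<in>UNIV. ?J l i * ?J k j * chart_pd d k (a l) p)"
    by (simp add: mult_ac)
  have "form_curl c a' i j p =
    (\<Sum>l\<in>UNIV. \<Sum>k\<in>UNIV. ?J l i * ?J k j * chart_pd d l (a k) p) -
    (\<Sum>l\<in>UNIV. \<Sum>k\<in>UNIV. ?J l i * ?J k j * chart_pd d k (a l) p)"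
    unfolding form_curl_def pd 1 2 chart_pd_cjac_commute[OF cd p, of i _ j] by simp
  then show ?thesis by (simp add: form_curl_def right_diff_distrib sum_subtractf)
qed

text \<open>Every term of the system is a tensor: the covector equation in c is the one in d
  multiplied by the Jacobian, once b is the image of b'. The factor g, a scalar, is the same in both
  charts.\<close>

lemma contact_system_pullback:
  assumes cd: "smooth_charts c d" and N: "open N" "p \<in> N" and p: "p \<in> fst c" "p \<in> fst d"
    and eq: "\<And>j q. q \<in> N \<Longrightarrow> q \<in> fst c \<Longrightarrow> q \<in> fst d \<Longrightarrow> a' j q = (\<Sum>k\<in>UNIV. cjac c d k j q * a k q)"
    and eqh: "\<And>q. q \<in> N \<Longrightarrow> q \<in> fst c \<Longrightarrow> q \<in> fst d \<Longrightarrow> h' q = h q"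
    and a: "\<And>j. chart_differentiable d (a j) p" and h: "chart_differentiable d h p"
    and b: "\<And>k. b $ k = (\<Sum>i\<in>UNIV. cjac c d k i p * b' $ i)"
    and sys: "contact_system d a h b g p"
  shows "contact_system c a' h' b' g p"
  unfolding contact_system_def
proof (intro conjI allI)
  note g = smooth_chartsD[OF cd]
  let ?J = "\<lambda>k i. cjac c d k i p"
  have N': "open (N \<inter> fst d)" "p \<in> N \<inter> fst d" using N g p by auto
  have s1: "(\<Sum>i\<in>UNIV. a i p * b $ i) = h p"
    and s2: "\<And>j. (\<Sum>i\<in>UNIV. b $ i * form_curl d a i j p) + chart_pd d j h p = g * a j p"
    using sys by (auto simp: contact_system_def)
  have a': "a' j p = (\<Sum>k\<in>UNIV. ?J k j * a k p)" for j using eq N p by blast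
  have "(\<Sum>i\<in>UNIV. a' i p * b' $ i) = (\<Sum>i\<in>UNIV. \<Sum>k\<in>UNIV. a k p * (?J k i * b' $ i))"
    unfolding a' by (simp add: sum_distrib_left sum_distrib_right mult_ac)
  also have "\<dots> = (\<Sum>k\<in>UNIV. a k p * b $ k)"
    unfolding b by (subst sum.swap) (simp add: sum_distrib_left)
  finally show "(\<Sum>i\<in>UNIV. a' i p * b' $ i) = h' p" using s1 eqh N p by simp
  fix j
  have "chart_pd c j h' p = chart_pd c j h p"
    by (rule chart_pd_cong[OF g(1) N' p(1), symmetric]) (use eqh cjac_chain(1)[OF cd p h] in auto)
  then have h': "chart_pd c j h' p = (\<Sum>k\<in>UNIV. ?J k j * chart_pd d k h p)"
    using cjac_chain(2)[OF cd p h] by simp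
  have curl: "form_curl c a' i j p =
      (\<Sum>l\<in>UNIV. \<Sum>k\<in>UNIV. ?J l i * ?J k j * form_curl d a l k p)" for i
    by (rule form_curl_pullback[OF cd N p _ a]) (rule eq)
  have "(\<Sum>i\<in>UNIV. b' $ i * form_curl c a' i j p) =
    (\<Sum>i\<in>UNIV. \<Sum>l\<in>UNIV. \<Sum>k\<in>UNIV. ?J k j * (?J l i * b' $ i * form_curl d a l k p))"
    unfolding curl by (simp add: sum_distrib_left mult_ac)
  also have "\<dots> = (\<Sum>l\<in>UNIV. \<Sum>k\<in>UNIV. \<Sum>i\<in>UNIV. ?J k j * (?J l i * b' $ i * form_curl d a l k p))"
    by (subst sum.swap) (intro sum.cong refl sum.swap)
  also have "\<dots> = (\<Sum>l\<in>UNIV. \<Sum>k\<in>UNIV. ?J k j * (b $ l * form_curl d a l k p))"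
    unfolding b by (simp add: sum_distrib_left sum_distrib_right)
  also have "\<dots> = (\<Sum>k\<in>UNIV. ?J k j * (\<Sum>l\<in>UNIV. b $ l * form_curl d a l k p))"
    by (subst sum.swap) (simp add: sum_distrib_left)
  finally have "(\<Sum>i\<in>UNIV. b' $ i * form_curl c a' i j p) + chart_pd c j h' p =
    (\<Sum>k\<in>UNIV. ?J k j * ((\<Sum>l\<in>UNIV. b $ l * form_curl d a l k p) + chart_pd d k h p))"
    unfolding h' by (simp add: distrib_left sum.distrib)
  also have "\<dots> = g * a' j p" unfolding s2 a' by (simp add: sum_distrib_left mult_ac)
  finally show "(\<Sum>i\<in>UNIV. b' $ i * form_curl c a' i j p) + chart_pd c j h' p = g * a' j p" .
qed

text \<open>Naturality of the bracket. The derivative of Y along X is not a vector: it picks up a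
  term with derivatives of the Jacobian. That term is symmetric in X and Y, hence drops out of the
  difference.\<close>

lemma lie_bracket_pushforward:
  assumes cd: "smooth_charts c d" and p: "p \<in> fst c" "p \<in> fst d"
    and X: "\<And>k q. q \<in> fst c \<Longrightarrow> q \<in> fst d \<Longrightarrow> X' k q = (\<Sum>i\<in>UNIV. cjac c d k i q * X i q)"
    and Y: "\<And>k q. q \<in> fst c \<Longrightarrow> q \<in> fst d \<Longrightarrow> Y' k q = (\<Sum>i\<in>UNIV. cjac c d k i q * Y i q)"
    and dX: "\<And>k. chart_differentiable c (X k) p" "\<And>k. chart_differentiable d (X' k) p"
    and dY: "\<And>k. chart_differentiable c (Y k) p" "\<And>k. chart_differentiable d (Y' k) p"
  shows "(\<Sum>j\<in>UNIV. X' j p * chart_pd d j (Y' k) p - Y' j p * chart_pd d j (X' k) p) =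
    (\<Sum>i\<in>UNIV. cjac c d k i p * (\<Sum>j\<in>UNIV. X j p * chart_pd c j (Y i) p - Y j p * chart_pd c j (X i) p))"
proof -
  note g = smooth_chartsD[OF cd]
  have half: "(\<Sum>j\<in>UNIV. X' j p * chart_pd d j (Y' k) p) =
    (\<Sum>i\<in>UNIV. cjac c d k i p * (\<Sum>j\<in>UNIV. X j p * chart_pd c j (Y i) p)) +
    (\<Sum>j\<in>UNIV. \<Sum>i\<in>UNIV. X j p * Y i p * chart_pd c j (cjac c d k i) p)"
    if X: "\<And>k q. q \<in> fst c \<Longrightarrow> q \<in> fst d \<Longrightarrow> X' k q = (\<Sum>i\<in>UNIV. cjac c d k i q * X i q)"
    and Y: "\<And>k q. q \<in> fst c \<Longrightarrow> q \<in> fst d \<Longrightarrow> Y' k q = (\<Sum>i\<in>UNIV. cjac c d k i q * Y i q)"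
    and dY: "\<And>k. chart_differentiable c (Y k) p" "\<And>k. chart_differentiable d (Y' k) p"
    for X Y X' Y' :: "'b \<Rightarrow> 'a \<Rightarrow> complex"
  proof -
    have m: "chart_differentiable c (\<lambda>q. cjac c d k i q * Y i q) p" for i
      by (rule chart_mult(1)[OF g(1) p(1) cjac_differentiable[OF cd p] dY(1)])
    have pdY: "chart_pd c j (Y' k) p =
      (\<Sum>i\<in>UNIV. cjac c d k i p * chart_pd c j (Y i) p + chart_pd c j (cjac c d k i) p * Y i p)" for j
    proof -
      have "chart_pd c j (Y' k) p = chart_pd c j (\<lambda>q. \<Sum>i\<in>UNIV. cjac c d k i q * Y i q) p"
        by (rule chart_pd_cong[OF g(1,5) p(2,1), symmetric]) (use Y in \<open>auto intro!: chart_sum[THEN conjunct1] m\<close>)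
      also have "\<dots> = (\<Sum>i\<in>UNIV. chart_pd c j (\<lambda>q. cjac c d k i q * Y i q) p)"
        by (intro chart_sum[THEN conjunct2] finite m)
      finally show ?thesis
        by (simp add: chart_mult(2)[OF g(1) p(1) cjac_differentiable[OF cd p] dY(1)])
    qed
    have "(\<Sum>l\<in>UNIV. X' l p * chart_pd d l (Y' k) p) =
      (\<Sum>l\<in>UNIV. \<Sum>j\<in>UNIV. X j p * (cjac c d l j p * chart_pd d l (Y' k) p))"
      unfolding X[OF p] by (simp add: sum_distrib_left sum_distrib_right mult_ac)
    also have "\<dots> = (\<Sum>j\<in>UNIV. X j p * chart_pd c j (Y' k) p)"
      unfolding cjac_chain(2)[OF cd p dY(2)] by (subst sum.swap) (simp add: sum_distrib_left)
    also have "\<dots> = (\<Sum>j\<in>UNIV. \<Sum>i\<in>UNIV. cjac c d k i p * (X j p * chart_pd c j (Y i) p)) +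
      (\<Sum>j\<in>UNIV. \<Sum>i\<in>UNIV. X j p * Y i p * chart_pd c j (cjac c d k i) p)"
      unfolding pdY by (simp add: sum_distrib_left sum.distrib distrib_left mult_ac)
    also have "(\<Sum>j\<in>UNIV. \<Sum>i\<in>UNIV. cjac c d k i p * (X j p * chart_pd c j (Y i) p)) =
      (\<Sum>i\<in>UNIV. cjac c d k i p * (\<Sum>j\<in>UNIV. X j p * chart_pd c j (Y i) p))"
      by (subst sum.swap) (simp add: sum_distrib_left)
    finally show ?thesis .
  qed
  have sym: "(\<Sum>j\<in>UNIV. \<Sum>i\<in>UNIV. X j p * Y i p * chart_pd c j (cjac c d k i) p) =
    (\<Sum>j\<in>UNIV. \<Sum>i\<in>UNIV. Y j p * X i p * chart_pd c j (cjac c d k i) p)"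
    by (subst sum.swap) (simp add: chart_pd_cjac_commute[OF cd p, of _ k] mult_ac)
  show ?thesis
    using half[OF X Y dY] half[OF Y X dX] sym
    by (simp add: sum_subtractf right_diff_distrib)
qed

section \<open>Solving the system by Cramer's rule\<close>

text \<open>The extra index \<open>None\<close> stands for the equation \<alpha>(B) = H among the
  rows and for the unknown g among the columns.\<close>

definition contact_matrix ::
    "('a, 'm::finite) chart \<Rightarrow> ('m \<Rightarrow> 'a \<Rightarrow> complex) \<Rightarrow> 'a \<Rightarrow> complex^('m option)^('m option)" where
  "contact_matrix c a p = (\<chi> r s. case r of
      None \<Rightarrow> (case s of None \<Rightarrow> 0 | Some i \<Rightarrow> a i p)
    | Some j \<Rightarrow> (case s of None \<Rightarrow> - a j p | Some i \<Rightarrow> form_curl c a i j p))"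

definition contact_rhs :: "('a, 'm::finite) chart \<Rightarrow> ('a \<Rightarrow> complex) \<Rightarrow> 'a \<Rightarrow> complex^('m option)" where
  "contact_rhs c h p = (\<chi> r. case r of None \<Rightarrow> h p | Some j \<Rightarrow> - chart_pd c j h p)"

lemma sum_UNIV_option:
  fixes f :: "'m::finite option \<Rightarrow> 'b::comm_monoid_add"
  shows "(\<Sum>s\<in>UNIV. f s) = f None + (\<Sum>i\<in>UNIV. f (Some i))"
  by (simp add: UNIV_option_conv sum.reindex)

lemma all_option: "(\<forall>r. P r) \<longleftrightarrow> P None \<and> (\<forall>j. P (Some j))"
  by (metis option.exhaust)

lemma contact_system_matrix:
  "contact_system c a h b g p \<longleftrightarrow>
    contact_matrix c a p *v (\<chi> s. case s of None \<Rightarrow> g | Some i \<Rightarrow> b $ i) = contact_rhs c h p"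
  by (auto simp: contact_system_def contact_matrix_def contact_rhs_def matrix_vector_mult_def vec_eq_iff
      sum_UNIV_option all_option mult.commute algebra_simps add_eq_0_iff)

text \<open>The entries are real at p, so the real and imaginary parts of a kernel vector are kernel
  vectors as well. For a real one nondegeneracy gives z = 0, then g \<alpha> = 0, and g = 0 because
  \<alpha> is nonzero.\<close>

lemma contact_matrix_det:
  fixes av :: "real^'m::finite"
  assumes a: "\<And>j. a j p = of_real (av $ j)" and D: "\<And>i j. form_curl c a i j p = of_real (D $ i $ j)"
    and nd: "contact_nondegenerate av D"
  shows "det (contact_matrix c a p) \<noteq> 0"
proof -
  have "x = 0" if x: "contact_matrix c a p *v x = 0" for x
  proof -
    have e1: "(\<Sum>i\<in>UNIV. of_real (av $ i) * x $ Some i) = 0"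
      using x a by (simp add: contact_matrix_def matrix_vector_mult_def vec_eq_iff sum_UNIV_option all_option)
    have e2: "(\<Sum>i\<in>UNIV. x $ Some i * of_real (D $ i $ j)) = x $ None * of_real (av $ j)" for j
      using x a D
      by (simp add: contact_matrix_def matrix_vector_mult_def vec_eq_iff sum_UNIV_option all_option mult.commute)
    have real: "z = 0 \<and> g = 0"
      if "(\<Sum>i\<in>UNIV. av $ i * z $ i) = 0" "\<And>j. (\<Sum>i\<in>UNIV. z $ i * D $ i $ j) = g * av $ j" for z :: "real^'m" and g
    proof -
      have "av \<bullet> z = 0" using that(1) by (simp add: inner_vec_def)
      with that(2) have "z = 0"
        using nd[unfolded contact_nondegenerate_def, THEN conjunct2, rule_format, of z g] by simp
      moreover have "av \<noteq> 0" using nd by (simp add: contact_nondegenerate_def)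
      then obtain j where "av $ j \<noteq> 0" by (auto simp: vec_eq_iff)
      ultimately show ?thesis using that(2)[of j] by simp
    qed
    have "(\<chi> i. Re (x $ Some i)) = 0 \<and> Re (x $ None) = 0"
      using arg_cong[OF e1, of Re] arg_cong[OF e2, of Re] by (intro real) (simp_all add: Re_sum)
    moreover have "(\<chi> i. Im (x $ Some i)) = 0 \<and> Im (x $ None) = 0"
      using arg_cong[OF e1, of Im] arg_cong[OF e2, of Im] by (intro real) (simp_all add: Im_sum)
    ultimately show "x = 0" by (simp add: vec_eq_iff all_option complex_eq_iff)
  qed
  then obtain B where "B ** contact_matrix c a p = mat 1"
    using matrix_left_invertible_ker[of "contact_matrix c a p"] by auto
  then have "det B * det (contact_matrix c a p) = 1" by (simp flip: det_mul)
  then show ?thesis by auto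
qed

lemma contact_system_unique:
  assumes det: "det (contact_matrix c a p) \<noteq> 0"
    and "contact_system c a h b g p" "contact_system c a h b' g' p"
  shows "b = b' \<and> g = g'"
proof -
  let ?x = "\<lambda>b g. \<chi> s. case s of None \<Rightarrow> g | Some i \<Rightarrow> b $ i"
  have "?x b g = ?x b' g'"
    using assms(2,3) unfolding contact_system_matrix cramer[OF det] by simp
  then show ?thesis by (simp add: vec_eq_iff all_option)
qed

lemma contact_system_smooth_solution:
  fixes a :: "'m::finite \<Rightarrow> 'a::topological_space \<Rightarrow> complex"
  assumes c: "good_chart c" and U: "open U" and a: "\<And>j. chart_smooth_on c U (a j)"
    and h: "chart_smooth_on c U h"
    and det: "\<And>p. p \<in> U \<Longrightarrow> p \<in> fst c \<Longrightarrow> det (contact_matrix c a p) \<noteq> 0"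
  obtains b g where "chart_smooth_on c U b" "chart_smooth_on c U g"
    "\<And>p. p \<in> U \<Longrightarrow> p \<in> fst c \<Longrightarrow> contact_system c a h (b p) (g p) p"
proof -
  let ?M = "\<lambda>p k. \<chi> r s. if s = k then contact_rhs c h p $ r else contact_matrix c a p $ r $ s"
  define x where "x p k = det (?M p k) / det (contact_matrix c a p)" for p k
  have sM: "chart_smooth_on c U (\<lambda>p. contact_matrix c a p $ r $ s)" for r s
    unfolding contact_matrix_def form_curl_def
    by (cases r; cases s)
       (auto intro!: chart_smooth_const a chart_smooth_uminus[OF c U] chart_smooth_diff[OF c U] chart_smooth_pd[OF c U])
  have sr: "chart_smooth_on c U (\<lambda>p. contact_rhs c h p $ r)" for r
    unfolding contact_rhs_def
    by (cases r) (auto intro!: h chart_smooth_uminus[OF c U] chart_smooth_pd[OF c U])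
  have "chart_smooth_on c U (\<lambda>p. ?M p k $ r $ s)" for k r s
    using sM[of r s] sr[of r] by (cases "s = k") simp_all
  then have sx: "chart_smooth_on c U (\<lambda>p. x p k)" for k
    unfolding x_def divide_inverse
    by (intro chart_smooth_mult[OF c U] chart_smooth_inverse[OF c U] chart_smooth_det[OF c U] det sM) auto
  show thesis
  proof
    show "chart_smooth_on c U (\<lambda>p. \<chi> i. x p (Some i))"
      by (rule chart_smooth_vec[OF c U]) (simp add: sx)
    show "chart_smooth_on c U (\<lambda>p. x p None)" by (rule sx)
    fix p assume p: "p \<in> U" "p \<in> fst c"
    have "(\<chi> s. case s of None \<Rightarrow> x p None | Some i \<Rightarrow> (\<chi> i. x p (Some i)) $ i) = (\<chi> k. x p k)"
      by (simp add: vec_eq_iff all_option)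
    then show "contact_system c a h (\<chi> i. x p (Some i)) (x p None) p"
      unfolding contact_system_matrix cramer[OF det[OF p]] x_def by simp
  qed
qed

section \<open>The contact vector field of a pair of tangent fields\<close>

text \<open>The argument order makes \<open>cform \<alpha> c\<close> a family of component functions
  as expected by \<open>form_curl\<close> and \<open>contact_system\<close>.\<close>

definition cform :: "('a, 'm::finite) form1 \<Rightarrow> ('a, 'm) chart \<Rightarrow> 'm \<Rightarrow> 'a \<Rightarrow> complex" where
  "cform \<alpha> c j q = of_real (\<alpha> c q $ j)"

lemma smooth_atlas_charts:
  assumes "smooth_atlas A" "c \<in> A" "d \<in> A"
  shows "smooth_charts c d"
proof -
  have g: "good_chart c" if "c \<in> A" for c
    using assms(1) that unfolding smooth_atlas_def good_chart_def by blast
  have s: "chart_smooth_on c (fst d) (snd d)" if "c \<in> A" "d \<in> A" for c d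
  proof -
    have "smooth_on (snd c ` (fst c \<inter> fst d)) (snd d \<circ> chart_inv c)"
      using assms(1) that unfolding smooth_atlas_def by blast
    then show ?thesis unfolding chart_smooth_on_def Int_commute[of "fst d"] .
  qed
  show ?thesis unfolding smooth_charts_def using g s assms(2,3) by simp
qed

lemma Vect_nth:
  assumes "X \<in> Vect A" "c \<in> A" "d \<in> A" "p \<in> fst c" "p \<in> fst d"
  shows "X d p $ k = (\<Sum>i\<in>UNIV. cjac c d k i p * X c p $ i)"
proof -
  have "\<forall>c\<in>A. \<forall>d\<in>A. \<forall>p\<in>fst c \<inter> fst d. X d p = map_matrix of_real (jacobian c d p) *v X c p"
    using assms(1) unfolding Vect_def by (elim CollectE conjE)
  then have "X d p = map_matrix of_real (jacobian c d p) *v X c p"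
    using assms(2-5) by blast
  then show ?thesis by (simp add: matrix_vector_mult_def map_matrix_def cjac_def)
qed

lemma VectI:
  assumes "\<And>c d p k. c \<in> A \<Longrightarrow> d \<in> A \<Longrightarrow> p \<in> fst c \<Longrightarrow> p \<in> fst d \<Longrightarrow>
      X d p $ k = (\<Sum>i\<in>UNIV. cjac c d k i p * X c p $ i)"
    and "\<And>c. c \<in> A \<Longrightarrow> chart_smooth_on c UNIV (X c)"
    and "\<And>c p. \<not> (c \<in> A \<and> p \<in> fst c) \<Longrightarrow> X c p = 0"
  shows "X \<in> Vect A"
  unfolding Vect_def
proof (intro CollectI conjI ballI allI impI)
  fix c d p assume "c \<in> A" "d \<in> A" "p \<in> fst c \<inter> fst d"
  then have "X d p $ k = (\<Sum>i\<in>UNIV. cjac c d k i p * X c p $ i)" for k using assms(1) by blast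
  then show "X d p = map_matrix of_real (jacobian c d p) *v X c p"
    by (subst vec_eq_iff) (simp add: matrix_vector_mult_def map_matrix_def cjac_def)
qed (use assms(2,3) in blast)+

lemma Vect_chart_smooth: "X \<in> Vect A \<Longrightarrow> c \<in> A \<Longrightarrow> chart_smooth_on c UNIV (X c)"
  unfolding Vect_def by blast

lemma Vect_smooth:
  assumes "X \<in> Vect A" "c \<in> A" "good_chart c" "open U"
  shows "chart_smooth_on c U (\<lambda>q. X c q $ i)"
  by (rule chart_smooth_nth[OF assms(3,4) chart_smooth_subset[OF Vect_chart_smooth[OF assms(1,2)]]]) simp

lemma Vect_diff:
  assumes A: "smooth_atlas A" and X: "X \<in> Vect A" and Y: "Y \<in> Vect A"
  shows "X - Y \<in> Vect A"
proof (rule VectI)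
  fix c d p k assume "c \<in> A" "d \<in> A" "p \<in> fst c" "p \<in> fst d"
  then show "(X - Y) d p $ k = (\<Sum>i\<in>UNIV. cjac c d k i p * (X - Y) c p $ i)"
    using Vect_nth[OF X] Vect_nth[OF Y] by (simp add: right_diff_distrib sum_subtractf)
next
  fix c assume c: "c \<in> A"
  have g: "good_chart c" using smooth_chartsD(1)[OF smooth_atlas_charts[OF A c c]] .
  have "chart_smooth_on c UNIV (\<lambda>q. X c q - Y c q)"
    by (intro chart_smooth_diff[OF g open_UNIV] Vect_chart_smooth[OF _ c] X Y)
  then show "chart_smooth_on c UNIV ((X - Y) c)" by (simp add: fun_diff_def)
next
  fix c p assume "\<not> (c \<in> A \<and> p \<in> fst c)"
  then have "X c p = 0" "Y c p = 0" using X Y unfolding Vect_def by blast+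
  then show "(X - Y) c p = 0" by simp
qed

lemma lie_bracket_Vect:
  assumes A: "smooth_atlas A" and X: "X \<in> Vect A" and Y: "Y \<in> Vect A"
  shows "lie_bracket A X Y \<in> Vect A"
proof (rule VectI)
  fix c d p k assume c: "c \<in> A" and d: "d \<in> A" and p: "p \<in> fst c" "p \<in> fst d"
  note cd = smooth_atlas_charts[OF A c d]
  have diff: "chart_differentiable e (\<lambda>q. Z e q $ i) p"
    if "e \<in> A" "p \<in> fst e" "Z \<in> Vect A" for e Z i
    by (rule chart_smooth_differentiable[OF Vect_smooth[OF that(3,1) _ open_UNIV] UNIV_I that(2)])
       (rule smooth_chartsD(1)[OF smooth_atlas_charts[OF A that(1) that(1)]])
  show "lie_bracket A X Y d p $ k = (\<Sum>i\<in>UNIV. cjac c d k i p * lie_bracket A X Y c p $ i)"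
    unfolding lie_bracket_def using c d p
    by (simp, intro lie_bracket_pushforward[OF cd p] Vect_nth[OF X c d] Vect_nth[OF Y c d] diff X Y)
next
  fix c assume c: "c \<in> A"
  have g: "good_chart c" using smooth_chartsD(1)[OF smooth_atlas_charts[OF A c c]] .
  have "chart_smooth_on c UNIV (\<lambda>p. \<chi> i. \<Sum>j\<in>UNIV. X c p $ j * chart_pd c j (\<lambda>q. Y c q $ i) p
                       - Y c p $ j * chart_pd c j (\<lambda>q. X c q $ i) p)"
    by (rule chart_smooth_vec[OF g open_UNIV], unfold vec_lambda_beta)
       (intro chart_smooth_sum[OF g open_UNIV] chart_smooth_diff[OF g open_UNIV] chart_smooth_mult[OF g open_UNIV]
        chart_smooth_pd[OF g open_UNIV] Vect_smooth[OF X c g open_UNIV] Vect_smooth[OF Y c g open_UNIV] finite)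
  then show "chart_smooth_on c UNIV (lie_bracket A X Y c)"
    by (rule chart_smooth_cong[OF g open_UNIV, rotated]) (simp add: lie_bracket_def c)
qed (auto simp: lie_bracket_def)

section \<open>Local contact forms and the Hamiltonian of a tangent pair\<close>

locale tangent_pair =
  fixes A :: "('a::{t2_space, second_countable_topology}, 'm::finite) chart set"
    and \<xi> :: "('a, 'm) distribution"
    and X Y :: "('a, 'm) vfield"
    and n :: nat
  assumes card: "CARD('m) = 2 * n + 1"
    and atlas: "smooth_atlas A"
    and contact: "contact_structure A n \<xi>"
    and X: "X \<in> TVect A n \<xi>" and Y: "Y \<in> TVect A n \<xi>"
begin

lemma charts: "c \<in> A \<Longrightarrow> d \<in> A \<Longrightarrow> smooth_charts c d"
  by (rule smooth_atlas_charts[OF atlas])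

lemma chart: "c \<in> A \<Longrightarrow> good_chart c"
  using smooth_chartsD(1)[OF charts] .

lemma XY_Vect: "X \<in> Vect A" "Y \<in> Vect A"
  using X Y by (auto simp: TVect_def)

abbreviation cf :: "'a set \<Rightarrow> ('a, 'm) form1 \<Rightarrow> bool" where
  "cf U \<alpha> \<equiv> contact_form_on A n \<xi> U \<alpha>"

lemma cf_open: "cf U \<alpha> \<Longrightarrow> open U"
  unfolding contact_form_on_def one_form_on_def by (elim conjE)

lemma cf_chart_smooth:
  assumes "cf U \<alpha>" "c \<in> A"
  shows "chart_smooth_on c U (\<alpha> c)"
proof -
  have "\<forall>c\<in>A. chart_smooth_on c U (\<alpha> c)"
    using assms(1) unfolding contact_form_on_def one_form_on_def by (elim conjE)
  then show ?thesis using assms(2) by (rule bspec)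
qed

lemma cf_transform:
  assumes "cf U \<alpha>" "c \<in> A" "d \<in> A" "p \<in> U" "p \<in> fst c" "p \<in> fst d"
  shows "\<alpha> c p = transpose (jacobian c d p) *v \<alpha> d p"
proof -
  have "\<forall>c\<in>A. \<forall>d\<in>A. \<forall>p\<in>U \<inter> fst c \<inter> fst d. \<alpha> c p = transpose (jacobian c d p) *v \<alpha> d p"
    using assms(1) unfolding contact_form_on_def one_form_on_def by (elim conjE)
  then show ?thesis using assms(2-6) by blast
qed

lemma cf_kernel:
  assumes "cf U \<alpha>" "c \<in> A" "p \<in> U" "p \<in> fst c"
  shows "\<xi> c p = {v. \<alpha> c p \<bullet> v = 0}" "\<exists>v. contact_volume n \<alpha> c p v \<noteq> 0"
proof -
  have "\<forall>c\<in>A. \<forall>p\<in>U \<inter> fst c. \<xi> c p = {v. \<alpha> c p \<bullet> v = 0} \<and> (\<exists>v. contact_volume n \<alpha> c p v \<noteq> 0)"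
    using assms(1) unfolding contact_form_on_def by (elim conjE)
  then show "\<xi> c p = {v. \<alpha> c p \<bullet> v = 0}" "\<exists>v. contact_volume n \<alpha> c p v \<noteq> 0"
    using assms(2-4) by blast+
qed

lemma cf_smooth:
  assumes "cf U \<alpha>" "c \<in> A"
  shows "chart_smooth_on c U (\<lambda>q. \<alpha> c q $ j)" "chart_smooth_on c U (cform \<alpha> c j)"
proof -
  show 1: "chart_smooth_on c U (\<lambda>q. \<alpha> c q $ j)"
    by (rule chart_smooth_nth[OF chart[OF assms(2)] cf_open[OF assms(1)] cf_chart_smooth[OF assms]])
  show "chart_smooth_on c U (cform \<alpha> c j)"
    unfolding cform_def
    by (rule chart_smooth_linear[OF chart[OF assms(2)] cf_open[OF assms(1)] bounded_linear_of_real 1])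
qed

lemma cf_differentiable:
  assumes "cf U \<alpha>" "c \<in> A" "p \<in> U" "p \<in> fst c"
  shows "chart_differentiable c (cform \<alpha> c j) p"
  by (rule chart_smooth_differentiable[OF cf_smooth(2)[OF assms(1,2)] assms(3,4)])

lemma cf_pd:
  assumes "cf U \<alpha>" "c \<in> A" "p \<in> U" "p \<in> fst c"
  shows "chart_pd c i (cform \<alpha> c j) p = of_real (chart_pd c i (\<lambda>q. \<alpha> c q $ j) p)"
  unfolding cform_def
  by (rule chart_linear(2)[OF bounded_linear_of_real
        chart_smooth_differentiable[OF cf_smooth(1)[OF assms(1,2)] assms(3,4)]])

lemma cf_curl:
  assumes "cf U \<alpha>" "c \<in> A" "p \<in> U" "p \<in> fst c"
  shows "form_curl c (cform \<alpha> c) i j p = of_real (ext_deriv \<alpha> c p $ i $ j)"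
  by (simp add: form_curl_def cf_pd[OF assms] ext_deriv_def)

lemma cf_nondegenerate:
  assumes "cf U \<alpha>" "c \<in> A" "p \<in> U" "p \<in> fst c"
  shows "contact_nondegenerate (\<alpha> c p) (ext_deriv \<alpha> c p)"
proof -
  obtain v where "contact_volume n \<alpha> c p v \<noteq> 0" using cf_kernel(2)[OF assms] by blast
  then show ?thesis by (rule contact_nondegenerateI[OF card])
qed

lemma cf_det:
  assumes "cf U \<alpha>" "c \<in> A" "p \<in> U" "p \<in> fst c"
  shows "det (contact_matrix c (cform \<alpha> c) p) \<noteq> 0"
  by (rule contact_matrix_det[OF _ cf_curl[OF assms] cf_nondegenerate[OF assms]]) (simp add: cform_def)

lemma cf_pullback:
  assumes "cf U \<alpha>" "c \<in> A" "d \<in> A" "p \<in> U" "p \<in> fst c" "p \<in> fst d"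
  shows "cform \<alpha> c j p = (\<Sum>k\<in>UNIV. cjac c d k j p * cform \<alpha> d k p)"
proof -
  have "\<alpha> c p $ j = (transpose (jacobian c d p) *v \<alpha> d p) $ j"
    by (rule arg_cong[OF cf_transform[OF assms]])
  then show ?thesis
    by (simp add: cform_def cjac_def matrix_vector_mult_def Finite_Cartesian_Product.transpose_def
        del: transpose_matrix_vector)
qed

lemma form_apply_tangent:
  assumes "Z \<in> TVect A n \<xi>" "cf U \<alpha>" "c \<in> A" "p \<in> U" "p \<in> fst c"
  shows "(\<Sum>i\<in>UNIV. cform \<alpha> c i p * Z c p $ i) = 0"
proof -
  have "\<forall>c\<in>A. \<forall>p\<in>U \<inter> fst c. form_apply \<alpha> Z c p = 0"
    using assms(1,2) unfolding TVect_def by blast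
  then show ?thesis using assms(3-5) by (simp add: form_apply_def cform_def)
qed

text \<open>Both forms have kernel \<xi>, hence are proportional. The quotient of Euclidean inner
  products of the components yields the ratio by one formula that is visibly smooth, without
  selecting a nonzero component.\<close>

lemma cf_ratio:
  assumes \<alpha>: "cf U \<alpha>" and \<beta>: "cf V \<beta>" and c: "c \<in> A"
  obtains f :: "'a \<Rightarrow> complex" where "chart_smooth_on c (U \<inter> V) f"
    "\<And>q. q \<in> U \<Longrightarrow> q \<in> V \<Longrightarrow> q \<in> fst c \<Longrightarrow> f q \<noteq> 0"
    "\<And>j q. q \<in> U \<Longrightarrow> q \<in> V \<Longrightarrow> q \<in> fst c \<Longrightarrow> cform \<beta> c j q = f q * cform \<alpha> c j q"
proof -
  define f where "f q = (\<Sum>j\<in>UNIV. cform \<beta> c j q * cform \<alpha> c j q) *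
    inverse (\<Sum>j\<in>UNIV. cform \<alpha> c j q * cform \<alpha> c j q)" for q
  define r where "r q = (\<beta> c q \<bullet> \<alpha> c q) / (\<alpha> c q \<bullet> \<alpha> c q)" for q
  have f: "f q = of_real (r q)" for q
    by (simp add: f_def r_def cform_def inner_vec_def divide_inverse)
  have nz: "\<alpha> c q \<noteq> 0" if "q \<in> U" "q \<in> fst c" for q
    using cf_nondegenerate[OF \<alpha> c that] by (simp add: contact_nondegenerate_def)
  have sq: "(\<Sum>j\<in>UNIV. cform \<alpha> c j q * cform \<alpha> c j q) \<noteq> 0" if "q \<in> U" "q \<in> fst c" for q
  proof -
    have "(\<Sum>j\<in>UNIV. cform \<alpha> c j q * cform \<alpha> c j q) = of_real (\<alpha> c q \<bullet> \<alpha> c q)"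
      by (simp add: cform_def inner_vec_def)
    then show ?thesis using nz[OF that] by simp
  qed
  have o: "open (U \<inter> V)" using cf_open \<alpha> \<beta> by blast
  have eq: "\<beta> c q = r q *\<^sub>R \<alpha> c q" if q: "q \<in> U" "q \<in> V" "q \<in> fst c" for q
  proof -
    \<comment> \<open>The part of \<beta> orthogonal to \<alpha>: it lies in ker \<alpha> = ker
      \<beta>, so it is orthogonal to itself.\<close>
    let ?v = "\<beta> c q - r q *\<^sub>R \<alpha> c q"
    have ker: "{v. \<alpha> c q \<bullet> v = 0} = {v. \<beta> c q \<bullet> v = 0}"
      using cf_kernel(1)[OF \<alpha> c q(1,3)] cf_kernel(1)[OF \<beta> c q(2,3)] by (rule trans[OF sym])
    have a: "\<alpha> c q \<bullet> ?v = 0"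
      using nz[OF q(1,3)] by (simp add: r_def inner_diff_right inner_commute)
    then have "\<beta> c q \<bullet> ?v = 0" using ker by blast
    with a have "?v \<bullet> ?v = 0" by (simp add: inner_diff_left)
    then show ?thesis by simp
  qed
  show thesis
  proof
    have "chart_smooth_on c (U \<inter> V) (cform \<alpha> c j)" "chart_smooth_on c (U \<inter> V) (cform \<beta> c j)" for j
      by (rule chart_smooth_subset[OF cf_smooth(2)[OF \<alpha> c]], blast)
         (rule chart_smooth_subset[OF cf_smooth(2)[OF \<beta> c]], blast)
    then show "chart_smooth_on c (U \<inter> V) f"
      unfolding f_def
      by (intro chart_smooth_mult[OF chart[OF c] o] chart_smooth_sum[OF chart[OF c] o]
          chart_smooth_inverse[OF chart[OF c] o] sq finite) auto
    fix q assume q: "q \<in> U" "q \<in> V" "q \<in> fst c"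
    have "\<beta> c q \<noteq> 0" using cf_nondegenerate[OF \<beta> c q(2,3)] by (simp add: contact_nondegenerate_def)
    then show "f q \<noteq> 0" using eq[OF q] f by auto
    fix j show "cform \<beta> c j q = f q * cform \<alpha> c j q"
      unfolding f cform_def eq[OF q] by simp
  qed
qed

lemma H_fun_curl:
  assumes "cf U \<alpha>" "c \<in> A" "q \<in> U" "q \<in> fst c"
  shows "H_fun \<alpha> X Y c q =
    (\<Sum>i\<in>UNIV. \<Sum>j\<in>UNIV. form_curl c (cform \<alpha> c) i j q * Y c q $ i * X c q $ j)"
  by (simp add: H_fun_def ext_deriv_apply_def cf_curl[OF assms])

lemma H_fun_smooth:
  assumes \<alpha>: "cf U \<alpha>" and c: "c \<in> A"
  shows "chart_smooth_on c U (H_fun \<alpha> X Y c)"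
proof (rule chart_smooth_cong)
  note g = chart[OF c] cf_open[OF \<alpha>]
  show "good_chart c" "open U" by fact+
  show "chart_smooth_on c U (\<lambda>q. \<Sum>i\<in>UNIV. \<Sum>j\<in>UNIV. form_curl c (cform \<alpha> c) i j q * Y c q $ i * X c q $ j)"
    unfolding form_curl_def
    by (intro chart_smooth_sum[OF g] chart_smooth_mult[OF g] chart_smooth_diff[OF g] chart_smooth_pd[OF g]
        cf_smooth(2)[OF \<alpha> c] Vect_smooth[OF XY_Vect(1) c g] Vect_smooth[OF XY_Vect(2) c g] finite)
qed (use H_fun_curl[OF assms] in simp)

text \<open>The Jacobians that pull d\<alpha> back from d to c are instead attached to X and Y,
  where they push the fields forward; the exchanges of sums only bring the indices of d
  outside.\<close>

lemma H_fun_chart: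
  assumes \<alpha>: "cf U \<alpha>" and c: "c \<in> A" and d: "d \<in> A" and p: "p \<in> U" "p \<in> fst c" "p \<in> fst d"
  shows "H_fun \<alpha> X Y c p = H_fun \<alpha> X Y d p"
proof -
  let ?D = "\<lambda>l k. form_curl d (cform \<alpha> d) l k p"
  let ?J = "\<lambda>k i. cjac c d k i p"
  have curl: "form_curl c (cform \<alpha> c) i j p = (\<Sum>l\<in>UNIV. \<Sum>k\<in>UNIV. ?J l i * ?J k j * ?D l k)" for i j
    by (rule form_curl_pullback[OF charts[OF c d] cf_open[OF \<alpha>] p])
       (use cf_pullback[OF \<alpha> c d] cf_differentiable[OF \<alpha> d p(1,3)] in auto)
  have "H_fun \<alpha> X Y c p =
    (\<Sum>i\<in>UNIV. \<Sum>j\<in>UNIV. \<Sum>l\<in>UNIV. \<Sum>k\<in>UNIV. ?D l k * (?J l i * Y c p $ i) * (?J k j * X c p $ j))"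
    unfolding H_fun_curl[OF \<alpha> c p(1,2)] curl by (simp add: sum_distrib_left sum_distrib_right mult_ac)
  also have "\<dots> = (\<Sum>i\<in>UNIV. \<Sum>l\<in>UNIV. \<Sum>j\<in>UNIV. \<Sum>k\<in>UNIV. ?D l k * (?J l i * Y c p $ i) * (?J k j * X c p $ j))"
    by (rule sum.cong[OF refl sum.swap])
  also have "\<dots> = (\<Sum>l\<in>UNIV. \<Sum>i\<in>UNIV. \<Sum>j\<in>UNIV. \<Sum>k\<in>UNIV. ?D l k * (?J l i * Y c p $ i) * (?J k j * X c p $ j))"
    by (rule sum.swap)
  also have "\<dots> = (\<Sum>l\<in>UNIV. \<Sum>i\<in>UNIV. \<Sum>k\<in>UNIV. \<Sum>j\<in>UNIV. ?D l k * (?J l i * Y c p $ i) * (?J k j * X c p $ j))"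
    by (rule sum.cong[OF refl sum.cong[OF refl sum.swap]])
  also have "\<dots> = (\<Sum>l\<in>UNIV. \<Sum>k\<in>UNIV. \<Sum>i\<in>UNIV. \<Sum>j\<in>UNIV. ?D l k * (?J l i * Y c p $ i) * (?J k j * X c p $ j))"
    by (rule sum.cong[OF refl sum.swap])
  also have "\<dots> = H_fun \<alpha> X Y d p"
    unfolding H_fun_curl[OF \<alpha> d p(1,3)] Vect_nth[OF XY_Vect(1) c d p(2,3)] Vect_nth[OF XY_Vect(2) c d p(2,3)]
    by (simp add: sum_distrib_left sum_distrib_right mult_ac)
  finally show ?thesis .
qed

section \<open>Construction of the contact field\<close>

definition sol :: "('a, 'm) form1 \<Rightarrow> ('a, 'm) chart \<Rightarrow> 'a \<Rightarrow> complex^'m \<Rightarrow> complex \<Rightarrow> bool" where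
  "sol \<alpha> c p b g \<longleftrightarrow> contact_system c (cform \<alpha> c) (H_fun \<alpha> X Y c) b g p"

lemma sol_unique:
  assumes "cf U \<alpha>" "c \<in> A" "p \<in> U" "p \<in> fst c" "sol \<alpha> c p b g" "sol \<alpha> c p b' g'"
  shows "b = b'" "g = g'"
  using contact_system_unique[OF cf_det[OF assms(1-4)] assms(5,6)[unfolded sol_def]] by auto

lemma sol_smooth:
  assumes \<alpha>: "cf U \<alpha>" and c: "c \<in> A"
  obtains b g where "chart_smooth_on c U b" "chart_smooth_on c U g"
    "\<And>p. p \<in> U \<Longrightarrow> p \<in> fst c \<Longrightarrow> sol \<alpha> c p (b p) (g p)"
  using contact_system_smooth_solution[OF chart[OF c] cf_open[OF \<alpha>] cf_smooth(2)[OF \<alpha> c] H_fun_smooth[OF \<alpha> c] cf_det[OF \<alpha> c]]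
  unfolding sol_def by blast

text \<open>Only b is common to the two contact forms; the factor depends on the form, hence the
  existential quantifier.\<close>

lemma sol_form_change:
  assumes \<alpha>: "cf U \<alpha>" and \<beta>: "cf V \<beta>" and c: "c \<in> A" and p: "p \<in> U" "p \<in> V" "p \<in> fst c"
    and s: "sol \<alpha> c p b g"
  shows "\<exists>g'. sol \<beta> c p b g'"
proof -
  obtain f where f: "chart_smooth_on c (U \<inter> V) f"
    "\<And>q. q \<in> U \<Longrightarrow> q \<in> V \<Longrightarrow> q \<in> fst c \<Longrightarrow> f q \<noteq> 0"
    "\<And>j q. q \<in> U \<Longrightarrow> q \<in> V \<Longrightarrow> q \<in> fst c \<Longrightarrow> cform \<beta> c j q = f q * cform \<alpha> c j q"
    using cf_ratio[OF \<alpha> \<beta> c] by blast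
  have N: "open (U \<inter> V)" "q \<in> U \<inter> V" if "q \<in> U" "q \<in> V" for q
    using cf_open \<alpha> \<beta> that by blast+
  have fd: "chart_differentiable c f q" if "q \<in> U" "q \<in> V" "q \<in> fst c" for q
    using chart_smooth_differentiable[OF f(1) N(2)[OF that(1,2)] that(3)] .
  \<comment> \<open>Tangency enters here: the two products produced by df \<and> \<alpha> contain
    \<alpha>(X) and \<alpha>(Y).\<close>
  have H: "H_fun \<beta> X Y c q = f q * H_fun \<alpha> X Y c q" if q: "q \<in> U \<inter> V" "q \<in> fst c" for q
  proof -
    have q': "q \<in> U" "q \<in> V" using q by auto
    let ?F = "\<lambda>i. chart_pd c i f q"
    let ?a = "\<lambda>i. cform \<alpha> c i q"
    have ax: "(\<Sum>i\<in>UNIV. ?a i * X c q $ i) = 0" "(\<Sum>i\<in>UNIV. ?a i * Y c q $ i) = 0"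
      by (rule form_apply_tangent[OF X \<alpha> c q'(1) q(2)], rule form_apply_tangent[OF Y \<alpha> c q'(1) q(2)])
    have curl: "form_curl c (cform \<beta> c) i j q =
        f q * form_curl c (cform \<alpha> c) i j q + ?F i * ?a j - ?F j * ?a i" for i j
      by (rule form_curl_scale[OF chart[OF c] N[OF q'] q(2) _ fd[OF q' q(2)] cf_differentiable[OF \<alpha> c q'(1) q(2)]])
         (use f(3) in auto)
    have "H_fun \<beta> X Y c q = (\<Sum>i\<in>UNIV. \<Sum>j\<in>UNIV.
        f q * (form_curl c (cform \<alpha> c) i j q * Y c q $ i * X c q $ j) +
        (?F i * Y c q $ i) * (?a j * X c q $ j) - (?a i * Y c q $ i) * (?F j * X c q $ j))"
      unfolding H_fun_curl[OF \<beta> c q'(2) q(2)] curl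
      by (intro sum.cong refl) (simp add: algebra_simps)
    also have "\<dots> = f q * H_fun \<alpha> X Y c q + (\<Sum>i\<in>UNIV. ?F i * Y c q $ i) * (\<Sum>i\<in>UNIV. ?a i * X c q $ i)
      - (\<Sum>i\<in>UNIV. ?a i * Y c q $ i) * (\<Sum>i\<in>UNIV. ?F i * X c q $ i)"
      unfolding H_fun_curl[OF \<alpha> c q'(1) q(2)] sum_product
      by (simp add: sum.distrib sum_subtractf sum_distrib_left)
    finally show ?thesis using ax by simp
  qed
  have hd: "chart_differentiable c (H_fun \<alpha> X Y c) p"
    by (rule chart_smooth_differentiable[OF H_fun_smooth[OF \<alpha> c] p(1,3)])
  show ?thesis
    unfolding sol_def
    by (rule exI, rule contact_system_scale[OF chart[OF c] N[OF p(1,2)] p(3) _ H fd[OF p]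
          cf_differentiable[OF \<alpha> c p(1,3)] hd f(2)[OF p] s[unfolded sol_def]])
       (use f(3) in auto)
qed

text \<open>\<open>contact_system_pullback\<close> transports a solution from its second chart to
  its first, so it is applied to the pair d, c; b is recovered from its image in d by the inverse
  Jacobian. That g is retained makes the factor a function on the manifold.\<close>

lemma sol_chart_change:
  assumes \<alpha>: "cf U \<alpha>" and c: "c \<in> A" and d: "d \<in> A" and p: "p \<in> U" "p \<in> fst c" "p \<in> fst d"
    and s: "sol \<alpha> c p b g"
  shows "sol \<alpha> d p (\<chi> k. \<Sum>i\<in>UNIV. cjac c d k i p * b $ i) g"
  unfolding sol_def
proof (rule contact_system_pullback[OF charts[OF d c] cf_open[OF \<alpha>] p(1,3,2)])
  fix k
  have "(\<Sum>i\<in>UNIV. cjac d c k i p * (\<Sum>l\<in>UNIV. cjac c d i l p * b $ l)) =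
      (\<Sum>l\<in>UNIV. (\<Sum>i\<in>UNIV. cjac d c k i p * cjac c d i l p) * b $ l)"
    by (simp add: sum_distrib_left sum_distrib_right mult.assoc) (rule sum.swap)
  then show "b $ k = (\<Sum>i\<in>UNIV. cjac d c k i p * (\<chi> k. \<Sum>i\<in>UNIV. cjac c d k i p * b $ i) $ i)"
    by (simp add: cjac_inverse[OF charts[OF d c] p(3,2)] if_distrib[of "\<lambda>x. x * _"] cong: if_cong)
next
  show "chart_differentiable c (cform \<alpha> c j) p" for j by (rule cf_differentiable[OF \<alpha> c p(1,2)])
  show "chart_differentiable c (H_fun \<alpha> X Y c) p"
    by (rule chart_smooth_differentiable[OF H_fun_smooth[OF \<alpha> c] p(1,2)])
  show "contact_system c (cform \<alpha> c) (H_fun \<alpha> X Y c) b g p" using s by (simp add: sol_def)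
qed (use cf_pullback[OF \<alpha> d c] H_fun_chart[OF \<alpha> d c] in auto)

text \<open>The description ranges over all contact forms near p, so no choice of one enters and the
  local solutions are glued by definition. The value 0 elsewhere is the one required by
  \<open>Vect\<close>.\<close>

definition Bfield :: "('a, 'm) vfield" where
  "Bfield c p = (if c \<in> A \<and> p \<in> fst c
     then THE b. \<exists>U \<alpha> g. cf U \<alpha> \<and> p \<in> U \<and> sol \<alpha> c p b g else 0)"

text \<open>A solution for another contact form also solves the system of \<alpha>, with another
  factor, and there b is unique.\<close>

lemma Bfield_eqI:
  assumes \<alpha>: "cf U \<alpha>" and c: "c \<in> A" and p: "p \<in> U" "p \<in> fst c" and s: "sol \<alpha> c p b g"
  shows "Bfield c p = b"
proof -
  have "(THE b. \<exists>U \<alpha> g. cf U \<alpha> \<and> p \<in> U \<and> sol \<alpha> c p b g) = b"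
  proof (rule the_equality)
    show "\<exists>U \<alpha> g. cf U \<alpha> \<and> p \<in> U \<and> sol \<alpha> c p b g" using \<alpha> p(1) s by (intro exI conjI)
    fix b' assume "\<exists>U \<alpha> g. cf U \<alpha> \<and> p \<in> U \<and> sol \<alpha> c p b' g"
    then obtain V \<beta> g' where \<beta>: "cf V \<beta>" "p \<in> V" "sol \<beta> c p b' g'" by (elim exE conjE)
    then obtain g'' where "sol \<alpha> c p b' g''"
      using sol_form_change[OF \<beta>(1) \<alpha> c \<beta>(2) p(1,2) \<beta>(3)] by (elim exE)
    then show "b' = b" using sol_unique(1)[OF \<alpha> c p _ s] by simp
  qed
  then show ?thesis using c p(2) by (simp add: Bfield_def)
qed

lemma Bfield_sol:
  assumes \<alpha>: "cf U \<alpha>" and c: "c \<in> A"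
  obtains g where "chart_smooth_on c U (Bfield c)" "chart_smooth_on c U g"
    "\<And>p. p \<in> U \<Longrightarrow> p \<in> fst c \<Longrightarrow> sol \<alpha> c p (Bfield c p) (g p)"
proof -
  obtain b g where b: "chart_smooth_on c U b" "chart_smooth_on c U g"
    "\<And>p. p \<in> U \<Longrightarrow> p \<in> fst c \<Longrightarrow> sol \<alpha> c p (b p) (g p)"
    using sol_smooth[OF \<alpha> c] by metis
  have eq: "Bfield c p = b p" if "p \<in> U" "p \<in> fst c" for p
    by (rule Bfield_eqI[OF \<alpha> c that b(3)[OF that]])
  show thesis
  proof
    show "chart_smooth_on c U (Bfield c)"
      by (rule chart_smooth_cong[OF chart[OF c] cf_open[OF \<alpha>] _ b(1)]) (simp add: eq)
    show "chart_smooth_on c U g" by (rule b(2))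
    show "sol \<alpha> c p (Bfield c p) (g p)" if "p \<in> U" "p \<in> fst c" for p
      using b(3)[OF that] eq[OF that] by simp
  qed
qed

lemma ex_cf: obtains U \<alpha> where "p \<in> U" "cf U \<alpha>"
  using contact unfolding contact_structure_def by blast

lemma Bfield_Vect: "Bfield \<in> Vect A"
proof (rule VectI)
  fix c d p k assume c: "c \<in> A" and d: "d \<in> A" and p: "p \<in> fst c" "p \<in> fst d"
  obtain U \<alpha> where U: "p \<in> U" and \<alpha>: "cf U \<alpha>" by (rule ex_cf)
  obtain g where "sol \<alpha> c p (Bfield c p) (g p)" using Bfield_sol[OF \<alpha> c] U p(1) by metis
  then have "Bfield d p = (\<chi> k. \<Sum>i\<in>UNIV. cjac c d k i p * Bfield c p $ i)"
    by (intro Bfield_eqI[OF \<alpha> d U p(2)] sol_chart_change[OF \<alpha> c d U p])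
  then show "Bfield d p $ k = (\<Sum>i\<in>UNIV. cjac c d k i p * Bfield c p $ i)" by simp
next
  fix c assume c: "c \<in> A"
  show "chart_smooth_on c UNIV (Bfield c)"
  proof (rule chart_smooth_local[OF chart[OF c]])
    fix p assume "p \<in> fst c"
    obtain U \<alpha> where "p \<in> U" and \<alpha>: "cf U \<alpha>" by (rule ex_cf)
    moreover have "chart_smooth_on c U (Bfield c)" using Bfield_sol[OF \<alpha> c] by metis
    ultimately show "\<exists>V. open V \<and> p \<in> V \<and> chart_smooth_on c V (Bfield c)"
      using cf_open[OF \<alpha>] by (intro exI[of _ U]) simp
  qed
qed (auto simp: Bfield_def)

section \<open>The contact property and uniqueness\<close>

text \<open>Cartan's formula in components: in d(\<alpha>(Z)) the terms that differentiate \<alpha>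
  cancel the second half of the curl.\<close>

lemma lie_deriv_Hamiltonian:
  assumes \<alpha>: "cf U \<alpha>" and c: "c \<in> A" and p: "p \<in> U" "p \<in> fst c" and Z: "Z \<in> Vect A"
    and h: "\<And>q. q \<in> U \<Longrightarrow> q \<in> fst c \<Longrightarrow> form_apply \<alpha> Z c q = h q"
  shows "lie_deriv Z \<alpha> c p $ j =
    (\<Sum>i\<in>UNIV. Z c p $ i * form_curl c (cform \<alpha> c) i j p) + chart_pd c j h p"
proof -
  note g = chart[OF c] cf_open[OF \<alpha>]
  have dZ: "chart_differentiable c (\<lambda>q. Z c q $ i) p" for i
    by (rule chart_smooth_differentiable[OF Vect_smooth[OF Z c g] p])
  note d\<alpha> = cf_differentiable[OF \<alpha> c p]
  have m: "chart_differentiable c (\<lambda>q. cform \<alpha> c i q * Z c q $ i) p" for i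
    by (rule chart_mult(1)[OF g(1) p(2) d\<alpha> dZ])
  have "chart_pd c j h p = chart_pd c j (\<lambda>q. \<Sum>i\<in>UNIV. cform \<alpha> c i q * Z c q $ i) p"
  proof (rule chart_pd_cong[OF g p, symmetric])
    show "chart_differentiable c (\<lambda>q. \<Sum>i\<in>UNIV. cform \<alpha> c i q * Z c q $ i) p"
      by (intro chart_sum[THEN conjunct1] finite m)
  qed (simp add: h[symmetric] form_apply_def cform_def)
  also have "\<dots> = (\<Sum>i\<in>UNIV. chart_pd c j (\<lambda>q. cform \<alpha> c i q * Z c q $ i) p)"
    by (intro chart_sum[THEN conjunct2] finite m)
  also have "\<dots> = (\<Sum>i\<in>UNIV. cform \<alpha> c i p * chart_pd c j (\<lambda>q. Z c q $ i) p
      + chart_pd c j (cform \<alpha> c i) p * Z c p $ i)"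
    by (simp add: chart_mult(2)[OF g(1) p(2) d\<alpha> dZ])
  finally have "(\<Sum>i\<in>UNIV. Z c p $ i * form_curl c (cform \<alpha> c) i j p) + chart_pd c j h p =
    (\<Sum>i\<in>UNIV. Z c p $ i * chart_pd c i (cform \<alpha> c j) p + cform \<alpha> c i p * chart_pd c j (\<lambda>q. Z c q $ i) p)"
    by (simp add: form_curl_def right_diff_distrib sum_subtractf sum.distrib mult.commute)
  then show ?thesis by (simp add: lie_deriv_def cf_pd[OF \<alpha> c p] cform_def[of _ _ _ p])
qed

text \<open>The bridge between the system and \<open>CVect\<close>: one direction shows that
  \<open>Bfield\<close> is a contact field, the other that every candidate for
  \<open>contact_B\<close> solves the system.\<close>

lemma sol_iff:
  assumes \<alpha>: "cf U \<alpha>" and c: "c \<in> A" and p: "p \<in> U" "p \<in> fst c" and Z: "Z \<in> Vect A"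
    and h: "\<And>q. q \<in> U \<Longrightarrow> q \<in> fst c \<Longrightarrow> form_apply \<alpha> Z c q = H_fun \<alpha> X Y c q"
  shows "sol \<alpha> c p (Z c p) g \<longleftrightarrow> (\<forall>j. lie_deriv Z \<alpha> c p $ j = g * of_real (\<alpha> c p $ j))"
proof -
  have "lie_deriv Z \<alpha> c p $ j =
      (\<Sum>i\<in>UNIV. Z c p $ i * form_curl c (cform \<alpha> c) i j p) + chart_pd c j (H_fun \<alpha> X Y c) p" for j
    by (rule lie_deriv_Hamiltonian[OF \<alpha> c p Z h])
  moreover have "(\<Sum>i\<in>UNIV. cform \<alpha> c i p * Z c p $ i) = H_fun \<alpha> X Y c p"
    using h[OF p] by (simp add: form_apply_def cform_def)
  ultimately show ?thesis by (simp add: sol_def contact_system_def cform_def[of _ _ _ p])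
qed

lemma Bfield_Hamiltonian:
  assumes "cf U \<alpha>" "c \<in> A" "p \<in> U" "p \<in> fst c"
  shows "form_apply \<alpha> Bfield c p = H_fun \<alpha> X Y c p"
proof -
  obtain g where "sol \<alpha> c p (Bfield c p) (g p)" using Bfield_sol[OF assms(1,2)] assms(3,4) by metis
  then show ?thesis by (simp add: sol_def contact_system_def form_apply_def cform_def)
qed

lemma Bfield_CVect: "Bfield \<in> CVect A n \<xi>"
  unfolding CVect_def
proof (intro CollectI conjI allI impI Bfield_Vect)
  fix U \<alpha> assume \<alpha>: "cf U \<alpha>"
  \<comment> \<open>\<open>CVect\<close> asks for a single factor on U, valid in all charts; it
    exists because a change of chart keeps g.\<close>
  define f where "f p = (THE g. \<exists>c\<in>A. p \<in> fst c \<and> sol \<alpha> c p (Bfield c p) g)" for p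
  have f: "f p = g" if c: "c \<in> A" and p: "p \<in> U" "p \<in> fst c" and s: "sol \<alpha> c p (Bfield c p) g" for c p g
    unfolding f_def
  proof (rule the_equality)
    show "\<exists>c\<in>A. p \<in> fst c \<and> sol \<alpha> c p (Bfield c p) g" using that by (intro bexI conjI)
    fix g' assume "\<exists>c\<in>A. p \<in> fst c \<and> sol \<alpha> c p (Bfield c p) g'"
    then obtain d where d: "d \<in> A" "p \<in> fst d" "sol \<alpha> d p (Bfield d p) g'" by (elim bexE conjE)
    from sol_chart_change[OF \<alpha> c d(1) p d(2) s] d(3) show "g' = g"
      by (rule sol_unique(2)[OF \<alpha> d(1) p(1) d(2), symmetric])
  qed
  have "chart_smooth_on c U f" if c: "c \<in> A" for c
  proof -
    obtain g where g: "chart_smooth_on c U g"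
      "\<And>p. p \<in> U \<Longrightarrow> p \<in> fst c \<Longrightarrow> sol \<alpha> c p (Bfield c p) (g p)"
      using Bfield_sol[OF \<alpha> c] by metis
    show ?thesis
      by (rule chart_smooth_cong[OF chart[OF c] cf_open[OF \<alpha>] _ g(1)]) (rule f[OF c _ _ g(2), symmetric])
  qed
  moreover have "lie_deriv Bfield \<alpha> c p $ j = f p * of_real (\<alpha> c p $ j)"
    if c: "c \<in> A" and p: "p \<in> U" "p \<in> fst c" for c p j
  proof -
    obtain g where g: "sol \<alpha> c p (Bfield c p) (g p)" using Bfield_sol[OF \<alpha> c] p by metis
    have "sol \<alpha> c p (Bfield c p) (f p)" unfolding f[OF c p g] by (rule g)
    then show ?thesis
      using sol_iff[OF \<alpha> c p Bfield_Vect Bfield_Hamiltonian[OF \<alpha> c]] by blast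
  qed
  ultimately show "\<exists>f. smooth_fun_on A U f \<and>
      (\<forall>c\<in>A. \<forall>p\<in>U \<inter> fst c. \<forall>j. lie_deriv Bfield \<alpha> c p $ j = f p * of_real (\<alpha> c p $ j))"
    unfolding smooth_fun_on_def by (intro exI[of _ f]) blast
qed

lemma contact_B_eq: "contact_B A n \<xi> X Y = Bfield"
  unfolding contact_B_def
proof (rule the_equality)
  show "Bfield \<in> CVect A n \<xi> \<and> (\<forall>U \<alpha>. cf U \<alpha> \<longrightarrow>
        (\<forall>c\<in>A. \<forall>p\<in>U \<inter> fst c. form_apply \<alpha> Bfield c p = H_fun \<alpha> X Y c p))"
    using Bfield_CVect Bfield_Hamiltonian by simp
  fix Z assume Z: "Z \<in> CVect A n \<xi> \<and> (\<forall>U \<alpha>. cf U \<alpha> \<longrightarrow>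
        (\<forall>c\<in>A. \<forall>p\<in>U \<inter> fst c. form_apply \<alpha> Z c p = H_fun \<alpha> X Y c p))"
  then have ZV: "Z \<in> Vect A" by (simp add: CVect_def)
  show "Z = Bfield"
  proof (intro ext)
    fix c p
    show "Z c p = Bfield c p"
    proof (cases "c \<in> A \<and> p \<in> fst c")
      case True
      then have c: "c \<in> A" and p: "p \<in> fst c" by auto
      obtain U \<alpha> where U: "p \<in> U" and \<alpha>: "cf U \<alpha>" by (rule ex_cf)
      have h: "form_apply \<alpha> Z c q = H_fun \<alpha> X Y c q" if "q \<in> U" "q \<in> fst c" for q
        using Z \<alpha> c that by simp
      obtain f where "\<forall>c\<in>A. \<forall>p\<in>U \<inter> fst c. \<forall>j. lie_deriv Z \<alpha> c p $ j = f p * of_real (\<alpha> c p $ j)"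
        using Z \<alpha> unfolding CVect_def by blast
      then have "\<forall>j. lie_deriv Z \<alpha> c p $ j = f p * of_real (\<alpha> c p $ j)"
        using c p U by blast
      then have "sol \<alpha> c p (Z c p) (f p)"
        using sol_iff[OF \<alpha> c U p ZV h] by blast
      then show ?thesis by (rule Bfield_eqI[OF \<alpha> c U p, symmetric])
    next
      case False
      \<comment> \<open>Equality of fields is also required where c is not a chart around p; there
        \<open>Vect\<close> forces both values to be 0.\<close>
      have "\<forall>c p. \<not> (c \<in> A \<and> p \<in> fst c) \<longrightarrow> Z c p = 0"
        using ZV unfolding Vect_def by blast
      with False have "Z c p = 0" by blast
      then show ?thesis using False by (auto simp: Bfield_def)
    qed
  qed
qed

section \<open>The Hamiltonian of the Lie bracket\<close>

lemma form_apply_lie_bracket: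
  assumes \<alpha>: "cf U \<alpha>" and c: "c \<in> A" and p: "p \<in> U" "p \<in> fst c"
  shows "form_apply \<alpha> (lie_bracket A X Y) c p = H_fun \<alpha> X Y c p"
proof -
  note g = chart[OF c] cf_open[OF \<alpha>]
  note d\<alpha> = cf_differentiable[OF \<alpha> c p]
  \<comment> \<open>The function \<alpha>(Z) vanishes on U, so by the product rule a derivative
    moves from Z to \<alpha> at the cost of a sign.\<close>
  have half: "(\<Sum>i\<in>UNIV. cform \<alpha> c i p * chart_pd c j (\<lambda>q. Z c q $ i) p) =
      - (\<Sum>i\<in>UNIV. chart_pd c j (cform \<alpha> c i) p * Z c p $ i)" if Z: "Z \<in> TVect A n \<xi>" for Z j
  proof -
    have ZV: "Z \<in> Vect A" using Z by (simp add: TVect_def)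
    have dZ: "chart_differentiable c (\<lambda>q. Z c q $ i) p" for i
      by (rule chart_smooth_differentiable[OF Vect_smooth[OF ZV c g] p])
    have m: "chart_differentiable c (\<lambda>q. cform \<alpha> c i q * Z c q $ i) p" for i
      by (rule chart_mult(1)[OF g(1) p(2) d\<alpha> dZ])
    have "0 = chart_pd c j (\<lambda>q. 0 :: complex) p" by (simp add: chart_const)
    also have "\<dots> = chart_pd c j (\<lambda>q. \<Sum>i\<in>UNIV. cform \<alpha> c i q * Z c q $ i) p"
      by (rule chart_pd_cong[OF g p _ chart_const(1)]) (use form_apply_tangent[OF Z \<alpha> c] in simp)
    also have "\<dots> = (\<Sum>i\<in>UNIV. chart_pd c j (\<lambda>q. cform \<alpha> c i q * Z c q $ i) p)"
      by (intro chart_sum[THEN conjunct2] finite m)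
    also have "\<dots> = (\<Sum>i\<in>UNIV. cform \<alpha> c i p * chart_pd c j (\<lambda>q. Z c q $ i) p) +
        (\<Sum>i\<in>UNIV. chart_pd c j (cform \<alpha> c i) p * Z c p $ i)"
      by (simp add: chart_mult(2)[OF g(1) p(2) d\<alpha> dZ] sum.distrib)
    finally show ?thesis by (simp add: eq_neg_iff_add_eq_0)
  qed
  have "form_apply \<alpha> (lie_bracket A X Y) c p = (\<Sum>i\<in>UNIV. \<Sum>j\<in>UNIV.
      X c p $ j * (cform \<alpha> c i p * chart_pd c j (\<lambda>q. Y c q $ i) p) -
      Y c p $ j * (cform \<alpha> c i p * chart_pd c j (\<lambda>q. X c q $ i) p))"
    using c p by (simp add: form_apply_def lie_bracket_def cform_def[of _ _ _ p] sum_distrib_left algebra_simps)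
  also have "\<dots> = (\<Sum>j\<in>UNIV.
      X c p $ j * (\<Sum>i\<in>UNIV. cform \<alpha> c i p * chart_pd c j (\<lambda>q. Y c q $ i) p) -
      Y c p $ j * (\<Sum>i\<in>UNIV. cform \<alpha> c i p * chart_pd c j (\<lambda>q. X c q $ i) p))"
    by (subst sum.swap) (simp add: sum_distrib_left sum_subtractf)
  \<comment> \<open>The remaining sums form the curl contracted with Y first and X second, the order
    in \<open>H_fun\<close>; this fixes the sign in the result.\<close>
  also have "\<dots> =
      (\<Sum>j\<in>UNIV. \<Sum>i\<in>UNIV. chart_pd c j (cform \<alpha> c i) p * Y c p $ j * X c p $ i) -
      (\<Sum>j\<in>UNIV. \<Sum>i\<in>UNIV. chart_pd c j (cform \<alpha> c i) p * X c p $ j * Y c p $ i)"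
    unfolding half[OF X] half[OF Y] by (simp add: sum_subtractf sum_negf sum_distrib_left mult_ac)
  also have "(\<Sum>j\<in>UNIV. \<Sum>i\<in>UNIV. chart_pd c j (cform \<alpha> c i) p * X c p $ j * Y c p $ i) =
      (\<Sum>j\<in>UNIV. \<Sum>i\<in>UNIV. chart_pd c i (cform \<alpha> c j) p * X c p $ i * Y c p $ j)"
    by (rule sum.swap)
  also have "(\<Sum>j\<in>UNIV. \<Sum>i\<in>UNIV. chart_pd c j (cform \<alpha> c i) p * Y c p $ j * X c p $ i) - \<dots> =
      H_fun \<alpha> X Y c p"
    unfolding H_fun_curl[OF \<alpha> c p] form_curl_def
    by (simp add: left_diff_distrib right_diff_distrib sum_subtractf mult_ac)
  finally show ?thesis .
qed

lemma lie_bracket_diff_tangent: "lie_bracket A X Y - contact_B A n \<xi> X Y \<in> TVect A n \<xi>"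
  unfolding contact_B_eq TVect_def
proof (intro CollectI conjI allI impI ballI)
  show "lie_bracket A X Y - Bfield \<in> Vect A"
    by (intro Vect_diff[OF atlas] lie_bracket_Vect[OF atlas] XY_Vect Bfield_Vect)
  fix U \<alpha> c p assume "cf U \<alpha>" "c \<in> A" "p \<in> U \<inter> fst c"
  then have "form_apply \<alpha> (lie_bracket A X Y) c p = form_apply \<alpha> Bfield c p"
    by (simp add: form_apply_lie_bracket Bfield_Hamiltonian)
  then show "form_apply \<alpha> (lie_bracket A X Y - Bfield) c p = 0"
    by (simp add: form_apply_def right_diff_distrib sum_subtractf)
qed

end

theorem proposition4p4:
  fixes A :: "('a::{t2_space, second_countable_topology}, 'm::finite) chart set"
    and \<xi> :: "('a, 'm) distribution"
    and X Y :: "('a, 'm) vfield"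
    and n :: nat
  assumes "n \<ge> 1" and "CARD('m) = 2 * n + 1"
    and "smooth_atlas A"
    and "contact_structure A n \<xi>"
    and "X \<in> TVect A n \<xi>" and "Y \<in> TVect A n \<xi>"
  shows "lie_bracket A X Y - contact_B A n \<xi> X Y \<in> TVect A n \<xi>"
proof -
  interpret tangent_pair A \<xi> X Y n
    by unfold_locales (fact assms)+
  show ?thesis by (rule lie_bracket_diff_tangent)
qed

end
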